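(* Let $\{M_h\}$ be a nondegenerate family of meshes subdividing $\Omega\subset\mathbb{R}^n$, with parameters $\gamma$ and $D$. Let $V_h$ consist of piecewise polynomials that include complete polynomials of degree $k$ on each element of $M_h$, such as: discontinuous Galerkin ($t=0$, $k\ge 0$); Lagrange ($t=1$, $k\ge 1$), Hermite ($t=1$, $k\geq 3$), tensor-product elements ($t=1$, $k\ge 1$); Argyris ($t=2$, $k\ge 5$ in two dimensions); as well as many others, with $t$ and $k$ as specified. Suppose that there are an approximation operator (interpolant) $\mathcal I_h$ into $V_h$ and a constant $C_I$ such that, for all $w\in H^{k+1}(\Omega)$, $$\sum_{m=0}^t \sum_{e} h_e^{2m}\,\Vert\nabla^m(w-\mathcal I_h w)\Vert_{L^2(e)}^2 \leq C_I \sum_{e} h_e^{2(k+1)}\, \Vert\nabla^{k+1} w\Vert_{L^2(e)}^2 .$$ Let $W_h$ be a finite element space defined on $M_h$, and let $u_h\in W_h$ be an approximation to a function $u\in H^{k+1}(\Omega)$ for which an error estimate holds of the form $$\Vert u-u_h\Vert_{L^2(\Omega)}^2 \leq C \sum_{e} h_e^{2(k+1)}\,\Vert\nabla^{k+1}u\Vert_{L^2(e)}^2 .$$ Let $\Pi_h$ be the $L^2(\Omega)$ projection onto $V_h$. Then $$\sum_{m=0}^t \sum_{e} h_e^{2m}\,\Vert\nabla^m(u-\Pi_h u_h)\Vert_{L^2(e)}^2 \leq C \sum_{e} h_e^{2(k+1)}\, \Vert\nabla^{k+1}u\Vert_{L^2(e)}^2 .$$ The constant $C$ depends only on $\gamma$,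 $D$ and $C_I$.
   Context: Meshes. $\Omega\subset\mathbb{R}^n$ is a domain, and each mesh $M_h$ is a subdivision of $\Omega$ into elements $e$ (simplices, cubes, prisms, etc.); sums over $e$ run over all $e\in M_h$. For $e\in M_h$, $\rho_e$ is the diameter of the largest sphere contained in $e$ and $h_e$ is the diameter of the smallest sphere containing $e$. Let $D$ be a finite, positive integer. The family $\{M_h\}$ is nondegenerate if there is a constant $\gamma$ such that, for all $h$ and $e$, $h_e\le\gamma\rho_e$ and such that $e$ is a union of at most $D$ domains that are star-shaped with respect to a ball of radius $h_e/\gamma$. (A domain is star-shaped with respect to a ball $B$ if, for each point $x$ of it, the convex hull of $\{x\}\cup B$ is contained in it.) The parameter $h$ is not a single mesh size but a function defined on the mesh that prescribes the local mesh size; no quasi-uniformity is assumed. Norms. $\nabla^m u$ is the tensor of $m$-th order partial derivatives of $u$, and $\Vert T\Vert_{L^2(e)}=\big(\int_e|T(x)|^2\,dx\big)^{1/2}$, where $|T|$ is the Euclidean norm of the tensor $T$ regarded as a vector of its components; $\Vert\cdot\Vert_{L^2(\Omega)}$ is defined likewise. $H^{s}(\Omega)$ is the set of functions whose derivatives of order up to $s$ are square integrable on $\Omega$. The functions in $W_h$ may be discontinuous, and $u_h$ may be scalar-, vector- or tensor-valued (for example, the gradient of a finite-element approximation). Projection. $\Pi_h:L^2(\Omega)\to V_h$ is defined by $(\Pi_h f,v)_{L^2(\Omega)}=(f,v)_{L^2(\Omega)}$ for all $v\in V_h$. As in the original, the letter $C$ is used for the constant both in the assumed error estimate for $u-u_h$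 and in the conclusion.
   Formalization: The piecewise polynomials in V_h have degree at most a fixed r, and the final constant may depend on r and on the C of the assumed estimate for u-u_h (besides n, k, t, the value space, γ, D, C_I); with unbounded degree and t≥1 the claim fails. *)

theory Defs
  imports "HOL-Analysis.Analysis"
begin

section \<open>Meshes\<close>

definition is_domain :: "'a::euclidean_space set \<Rightarrow> bool" where
  "is_domain \<Omega> \<longleftrightarrow> open \<Omega> \<and> connected \<Omega> \<and> \<Omega> \<noteq> {}"

text \<open>
  Elements may be taken closed (with disjoint interiors) or open, or anything in between; this is
  why closures and interiors appear below. Domains such as slit domains must not have elements
  reaching across the slit, hence the condition that interiors lie in \<open>\<Omega>\<close>.
\<close>

definition is_mesh :: "'a::euclidean_space set \<Rightarrow> 'a set set \<Rightarrow> bool" where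
  "is_mesh \<Omega> M \<longleftrightarrow>
     finite M \<and>
     (\<forall>e\<in>M. bounded e \<and> interior e \<noteq> {} \<and> interior e \<subseteq> \<Omega>) \<and>
     (\<forall>e\<in>M. \<forall>e'\<in>M. e \<noteq> e' \<longrightarrow> interior e \<inter> interior e' = {}) \<and>
     (\<Union>e\<in>M. closure e) = closure \<Omega>"

definition outer_diam :: "'a::euclidean_space set \<Rightarrow> real" where
  "outer_diam e = Inf {2 * R | R. \<exists>c. e \<subseteq> cball c R}"

definition inner_diam :: "'a::euclidean_space set \<Rightarrow> real" where
  "inner_diam e = Sup {2 * R | R. 0 \<le> R \<and> (\<exists>c. ball c R \<subseteq> e)}"

definition star_shaped_wrt :: "'a::real_vector set \<Rightarrow> 'a set \<Rightarrow> bool" where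
  "star_shaped_wrt S B \<longleftrightarrow> (\<forall>x\<in>S. convex hull ({x} \<union> B) \<subseteq> S)"

text \<open>
  The pieces \<open>S\<close> are not required to be open, so that closed elements are covered. A nonempty set
  that is star-shaped with respect to a ball of positive radius is connected and lies between its
  interior and the closure of its interior. The family is indexed by a set \<open>H\<close>; an index may be
  thought of as a function prescribing the local mesh size, but nothing is assumed about it.
\<close>

definition nondegenerate :: "real \<Rightarrow> nat \<Rightarrow> 'i set \<Rightarrow> ('i \<Rightarrow> 'a::euclidean_space set set) \<Rightarrow> bool" where
  "nondegenerate \<gamma> D H M \<longleftrightarrow>
     (\<forall>h\<in>H. \<forall>e\<in>M h.
        outer_diam e \<le> \<gamma> * inner_diam e \<and>
        (\<exists>\<S>. finite \<S> \<and> card \<S> \<le> D \<and> \<Union>\<S> = e \<and>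
             (\<forall>S\<in>\<S>. S \<noteq> {} \<and> (\<exists>c. star_shaped_wrt S (ball c (outer_diam e / \<gamma>))))))"

section \<open>Square integrable functions, weak derivatives, Sobolev spaces\<close>

text \<open>
  Functions take values in a Euclidean space \<open>'b\<close>, which covers the scalar, vector and tensor
  cases. They are genuine functions rather than equivalence classes. Only squares of norms are
  needed; they are valued in \<open>ennreal\<close>, so that a divergent integral is \<open>\<infinity>\<close>.
\<close>

definition L2_norm_sq :: "'a::euclidean_space set \<Rightarrow> ('a \<Rightarrow> 'b::euclidean_space) \<Rightarrow> ennreal" where
  "L2_norm_sq S f = (\<integral>\<^sup>+x. ennreal ((norm (f x))\<^sup>2) \<partial>lebesgue_on S)"

definition L2_space :: "'a::euclidean_space set \<Rightarrow> ('a \<Rightarrow> 'b::euclidean_space) set" where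
  "L2_space S = {f. f \<in> borel_measurable (lebesgue_on S) \<and> L2_norm_sq S f < \<infinity>}"

definition L2_inner ::
  "'a::euclidean_space set \<Rightarrow> ('a \<Rightarrow> 'b::euclidean_space) \<Rightarrow> ('a \<Rightarrow> 'b) \<Rightarrow> real" where
  "L2_inner S f g = (\<integral>x. f x \<bullet> g x \<partial>lebesgue_on S)"

text \<open>\<open>pderivs bs f\<close> is the iterated partial derivative of \<open>f\<close> in the directions listed in \<open>bs\<close>.\<close>

definition pderivs :: "'a::euclidean_space list \<Rightarrow> ('a \<Rightarrow> real) \<Rightarrow> 'a \<Rightarrow> real" where
  "pderivs bs f = foldr (\<lambda>b g x. frechet_derivative g (at x) b) bs f"

definition smooth :: "('a::euclidean_space \<Rightarrow> real) \<Rightarrow> bool" where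
  "smooth f \<longleftrightarrow> (\<forall>bs\<in>lists Basis. \<forall>x. pderivs bs f differentiable (at x))"

definition test_function :: "'a::euclidean_space set \<Rightarrow> ('a \<Rightarrow> real) \<Rightarrow> bool" where
  "test_function U \<phi> \<longleftrightarrow>
     smooth \<phi> \<and> compact (closure {x. \<phi> x \<noteq> 0}) \<and> closure {x. \<phi> x \<noteq> 0} \<subseteq> U"

definition locally_integrable ::
  "'a::euclidean_space set \<Rightarrow> ('a \<Rightarrow> 'b::euclidean_space) \<Rightarrow> bool" where
  "locally_integrable U f \<longleftrightarrow> (\<forall>K. compact K \<and> K \<subseteq> U \<longrightarrow> f absolutely_integrable_on K)"

text \<open>
  For \<open>bs = []\<close> the clause on almost everywhere equality is implied by the integral identity (it is
  the fundamental lemma of the calculus of variations); it only makes explicit that the derivative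
  of order zero is the function itself.
\<close>

definition has_weak_deriv ::
  "'a::euclidean_space set \<Rightarrow> 'a list \<Rightarrow> ('a \<Rightarrow> 'b::euclidean_space) \<Rightarrow> ('a \<Rightarrow> 'b) \<Rightarrow> bool" where
  "has_weak_deriv U bs f g \<longleftrightarrow>
     locally_integrable U f \<and> locally_integrable U g \<and>
     (bs = [] \<longrightarrow> (AE x in lebesgue_on U. g x = f x)) \<and>
     (\<forall>\<phi>. test_function U \<phi> \<longrightarrow>
        (\<integral>x. pderivs bs \<phi> x *\<^sub>R f x \<partial>lebesgue_on U) =
        (- 1) ^ length bs *\<^sub>R (\<integral>x. \<phi> x *\<^sub>R g x \<partial>lebesgue_on U))"

definition sobolev_space :: "nat \<Rightarrow> 'a::euclidean_space set \<Rightarrow> ('a \<Rightarrow> 'b::euclidean_space) set" where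
  "sobolev_space s \<Omega> =
     {f. \<forall>bs\<in>lists Basis. length bs \<le> s \<longrightarrow> (\<exists>g\<in>L2_space \<Omega>. has_weak_deriv \<Omega> bs f g)}"

text \<open>
  The tensor \<open>\<nabla>\<^sup>m f\<close> has one component for each list of \<open>m\<close> basis directions.
  \<open>grad_norm_sq m S f\<close> is \<open>\<parallel>\<nabla>\<^sup>m f\<parallel>\<^sup>2\<close> in \<open>L\<^sup>2(S)\<close>, with the derivatives taken in the interior of \<open>S\<close>
  (so functions may jump between elements). Weak derivatives are unique up to null sets, so that the
  infimum merely selects the common value of the integral (the elements considered have null
  boundary); it is \<open>\<infinity>\<close> if a weak derivative of order \<open>m\<close> does not exist.
\<close>

definition dir_lists :: "nat \<Rightarrow> 'a::euclidean_space list set" where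
  "dir_lists m = {bs. set bs \<subseteq> Basis \<and> length bs = m}"

definition grad_norm_sq ::
  "nat \<Rightarrow> 'a::euclidean_space set \<Rightarrow> ('a \<Rightarrow> 'b::euclidean_space) \<Rightarrow> ennreal" where
  "grad_norm_sq m S f =
     (INF G \<in> {G. \<forall>bs\<in>dir_lists m. has_weak_deriv (interior S) bs f (G bs)}.
        \<integral>\<^sup>+x. ennreal (\<Sum>bs\<in>dir_lists m. (norm (G bs x))\<^sup>2) \<partial>lebesgue_on S)"

section \<open>Finite element spaces\<close>

definition poly_deg_le :: "nat \<Rightarrow> ('a::euclidean_space \<Rightarrow> 'b::euclidean_space) \<Rightarrow> bool" where
  "poly_deg_le r p \<longleftrightarrow>
     (\<exists>c. \<forall>x. p x =
        (\<Sum>\<alpha> | (\<forall>b. b \<notin> Basis \<longrightarrow> \<alpha> b = (0::nat)) \<and> (\<Sum>b\<in>Basis. \<alpha> b) \<le> r.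
           (\<Prod>b\<in>Basis. (x \<bullet> b) ^ \<alpha> b) *\<^sub>R c \<alpha>))"

definition linear_space :: "('a \<Rightarrow> 'b::real_vector) set \<Rightarrow> bool" where
  "linear_space V \<longleftrightarrow>
     (\<lambda>x. 0) \<in> V \<and>
     (\<forall>v\<in>V. \<forall>w\<in>V. (\<lambda>x. v x + w x) \<in> V) \<and>
     (\<forall>a. \<forall>v\<in>V. (\<lambda>x. a *\<^sub>R v x) \<in> V)"

text \<open>
  Piecewise polynomials of degree at most \<open>r\<close>, including the complete polynomials of degree \<open>k\<close>
  on each element. Values on element boundaries, a null set, are left free, since discontinuous
  functions have no canonical values there. The bound \<open>r\<close> is meant to be shared by a whole family
of meshes: inverse estimates for polynomials are not uniform in the degree.
\<close>

definition piecewise_poly_space ::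
  "nat \<Rightarrow> nat \<Rightarrow> 'a::euclidean_space set set \<Rightarrow> ('a \<Rightarrow> 'b::euclidean_space) set \<Rightarrow> bool" where
  "piecewise_poly_space k r M V \<longleftrightarrow>
     linear_space V \<and>
     (\<forall>v\<in>V. \<forall>e\<in>M. \<exists>p. poly_deg_le r p \<and> (\<forall>x\<in>interior e. v x = p x)) \<and>
     (\<forall>e\<in>M. \<forall>p. poly_deg_le k p \<longrightarrow> (\<exists>v\<in>V. \<forall>x\<in>interior e. v x = p x))"

text \<open>
  A general finite element space: square integrable functions given on each element by a linear
  combination of finitely many shape functions \<open>F\<close> (not necessarily polynomials), without any
  continuity between elements.
\<close>

definition finite_element_space ::
  "'a::euclidean_space set \<Rightarrow> 'a set set \<Rightarrow> ('a \<Rightarrow> 'b::euclidean_space) set \<Rightarrow> bool" where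
  "finite_element_space \<Omega> M W \<longleftrightarrow>
     linear_space W \<and> W \<subseteq> L2_space \<Omega> \<and>
     (\<forall>e\<in>M. \<exists>F. finite F \<and>
        (\<forall>w\<in>W. \<exists>c. \<forall>x\<in>interior e. w x = (\<Sum>f\<in>F. c f *\<^sub>R f x)))"

definition is_L2_projection ::
  "'a::euclidean_space set \<Rightarrow> ('a \<Rightarrow> 'b::euclidean_space) set \<Rightarrow> (('a \<Rightarrow> 'b) \<Rightarrow> ('a \<Rightarrow> 'b)) \<Rightarrow> bool" where
  "is_L2_projection \<Omega> V P \<longleftrightarrow>
     (\<forall>f\<in>L2_space \<Omega>. P f \<in> V \<and> (\<forall>v\<in>V. L2_inner \<Omega> (P f) v = L2_inner \<Omega> f v))"

section \<open>The quantities in the error estimates\<close>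

definition error_lhs ::
  "nat \<Rightarrow> 'a::euclidean_space set set \<Rightarrow> ('a \<Rightarrow> 'b::euclidean_space) \<Rightarrow> ennreal" where
  "error_lhs t M f = (\<Sum>m=0..t. \<Sum>e\<in>M. ennreal (outer_diam e ^ (2 * m)) * grad_norm_sq m e f)"

definition error_rhs ::
  "nat \<Rightarrow> 'a::euclidean_space set set \<Rightarrow> ('a \<Rightarrow> 'b::euclidean_space) \<Rightarrow> ennreal" where
  "error_rhs k M f =
     (\<Sum>e\<in>M. ennreal (outer_diam e ^ (2 * (k + 1))) * grad_norm_sq (k + 1) e f)"

end

theory Submission
  imports Defs "HOL-Computational_Algebra.Polynomial"
begin

text \<open>
  Write \<open>I u\<close> for the interpolant and \<open>\<Pi>\<close> for the projection onto the piecewise polynomials, and split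
  the error as \<open>u - \<Pi> u\<^sub>h = (u - I u) + v\<close> with \<open>v = I u - \<Pi> u\<^sub>h\<close>. The first part is bounded by assumption.
  The second part is a piecewise polynomial, so that an inverse estimate on each element bounds
  \<open>h\<^sub>e\<^sup>m \<parallel>\<nabla>\<^sup>m v\<parallel>\<close> by a multiple of \<open>\<parallel>v\<parallel>\<close> (lemma \<open>element_inverse_estimate\<close>). Summing
  over the elements leaves the norm of \<open>v\<close> on \<open>\<Omega>\<close>. Since \<open>v = \<Pi> (I u - u\<^sub>h)\<close> and \<open>\<Pi>\<close> is a contraction
  (lemma \<open>L2_projection_error_le\<close>), that norm is at most \<open>\<parallel>I u - u\<parallel> + \<parallel>u - u\<^sub>h\<parallel>\<close>, and both terms
  are controlled by the assumptions, the first because the interpolation error includes \<open>m = 0\<close>.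

  The inverse estimate rests on interpolation on lines. A polynomial of degree at most \<open>r\<close> restricted to a
  line is determined by its values at \<open>r + 1\<close> nodes, so that its values further out on the line and its
  derivative are fixed combinations of these values (lemma \<open>sampling_nodes\<close>). Integrating the squares
  over balls bounds derivatives on a ball by the polynomial on a larger ball, and the polynomial on a
  large ball by the polynomial on a small one (lemma \<open>inverse_estimate_balls\<close>). A nondegenerate element
  lies between two concentric balls whose radii are in a ratio bounded in terms of \<open>\<gamma>\<close>.

  Because norms of derivatives are defined by weak derivatives on the interiors of elements, two further
  facts are needed: the iterated directional derivatives of a polynomial are its weak derivatives
  (lemma \<open>has_weak_deriv_poly_on_lines\<close>), and the frontier of an element is a null set, being covered by
  frontiers of star-shaped pieces (lemma \<open>negligible_frontier_star_shaped\<close>). The latter turns integrals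
  over \<open>\<Omega>\<close> into sums over the elements.
\<close>

section \<open>Polynomials on lines\<close>

text \<open>
  The only features of a polynomial of total degree at most \<open>r\<close> used below are its continuity and
  the fact that it restricts to a univariate polynomial of degree at most \<open>r\<close> on every line. This
  class is stable under translations and linear combinations, so directional derivatives stay in it
  without any computation with multi-indices.
\<close>
definition poly_on_lines :: "nat \<Rightarrow> ('a::real_vector \<Rightarrow> 'b::real_vector) \<Rightarrow> bool" where
  "poly_on_lines r p \<longleftrightarrow> (\<forall>x v. \<exists>a. \<forall>s::real. p (x + s *\<^sub>R v) = (\<Sum>i\<le>r. s ^ i *\<^sub>R a i))"

lemma poly_on_lines_0: "poly_on_lines r (\<lambda>x. 0)"
  unfolding poly_on_lines_def by (intro allI exI[of _ "\<lambda>_. 0"]) simp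

lemma poly_on_lines_add:
  assumes "poly_on_lines r p" "poly_on_lines r q"
  shows "poly_on_lines r (\<lambda>x. p x + q x)"
  unfolding poly_on_lines_def
proof (intro allI)
  fix x v
  obtain a b where "\<forall>s. p (x + s *\<^sub>R v) = (\<Sum>i\<le>r. s ^ i *\<^sub>R a i)" "\<forall>s. q (x + s *\<^sub>R v) = (\<Sum>i\<le>r. s ^ i *\<^sub>R b i)"
    using assms unfolding poly_on_lines_def by metis
  then show "\<exists>a. \<forall>s. p (x + s *\<^sub>R v) + q (x + s *\<^sub>R v) = (\<Sum>i\<le>r. s ^ i *\<^sub>R a i)"
    by (intro exI[of _ "\<lambda>i. a i + b i"]) (simp add: scaleR_add_right sum.distrib)
qed

lemma poly_on_lines_scaleR:
  assumes "poly_on_lines r p"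
  shows "poly_on_lines r (\<lambda>x. c *\<^sub>R p x)"
  unfolding poly_on_lines_def
proof (intro allI)
  fix x v
  obtain a where "\<forall>s. p (x + s *\<^sub>R v) = (\<Sum>i\<le>r. s ^ i *\<^sub>R a i)" 
    using assms unfolding poly_on_lines_def by metis
  then show "\<exists>a. \<forall>s. c *\<^sub>R p (x + s *\<^sub>R v) = (\<Sum>i\<le>r. s ^ i *\<^sub>R a i)"
    by (intro exI[of _ "\<lambda>i. c *\<^sub>R a i"]) (simp add: scaleR_sum_right mult.commute)
qed

lemma poly_on_lines_sum:
  assumes "finite A" "\<And>j. j \<in> A \<Longrightarrow> poly_on_lines r (p j)"
  shows "poly_on_lines r (\<lambda>x. \<Sum>j\<in>A. p j x)"
  using assms by (induction A rule: finite_induct) (auto simp: poly_on_lines_0 poly_on_lines_add)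

lemma poly_on_lines_translate:
  assumes "poly_on_lines r p"
  shows "poly_on_lines r (\<lambda>x. p (x + y))"
  unfolding poly_on_lines_def
proof (intro allI)
  fix x v
  obtain a where "\<forall>s. p (x + y + s *\<^sub>R v) = (\<Sum>i\<le>r. s ^ i *\<^sub>R a i)" 
    using assms unfolding poly_on_lines_def by metis
  then show "\<exists>a. \<forall>s. p (x + s *\<^sub>R v + y) = (\<Sum>i\<le>r. s ^ i *\<^sub>R a i)"
    by (intro exI[of _ a]) (simp add: algebra_simps)
qed

lemma poly_on_lines_monomial:
  fixes c :: "'b::real_vector" and \<alpha> :: "'a::euclidean_space \<Rightarrow> nat"
  assumes "(\<Sum>b\<in>Basis. \<alpha> b) \<le> r"
  shows "poly_on_lines r (\<lambda>x::'a. (\<Prod>b\<in>Basis. (x \<bullet> b) ^ \<alpha> b) *\<^sub>R c)"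
  unfolding poly_on_lines_def
proof (intro allI)
  fix x v :: 'a
  define P where "P = (\<Prod>b\<in>Basis. [:x \<bullet> b, v \<bullet> b:] ^ \<alpha> b)"
  have "degree P \<le> (\<Sum>b\<in>Basis. degree ([:x \<bullet> b, v \<bullet> b:] ^ \<alpha> b))"
    unfolding P_def by (rule degree_prod_sum_le[unfolded o_def]) simp
  also have "\<dots> \<le> (\<Sum>b\<in>Basis. \<alpha> b)"
  proof (rule sum_mono)
    fix b :: 'a
    have "degree ([:x \<bullet> b, v \<bullet> b:] ^ \<alpha> b) \<le> degree [:x \<bullet> b, v \<bullet> b:] * \<alpha> b"
      by (rule degree_power_le)
    also have "\<dots> \<le> 1 * \<alpha> b" by (intro mult_right_mono) auto
    finally show "degree ([:x \<bullet> b, v \<bullet> b:] ^ \<alpha> b) \<le> \<alpha> b" by simp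
  qed
  finally have deg: "degree P \<le> r" using assms by linarith
  have val: "(\<Prod>b\<in>Basis. ((x + s *\<^sub>R v) \<bullet> b) ^ \<alpha> b) = (\<Sum>i\<le>r. s ^ i * coeff P i)" for s
  proof -
    have "(\<Prod>b\<in>Basis. ((x + s *\<^sub>R v) \<bullet> b) ^ \<alpha> b) = poly P s"
      unfolding P_def by (simp add: poly_prod inner_add_left)
    also have "\<dots> = (\<Sum>i\<le>r. s ^ i * coeff P i)"
      unfolding poly_altdef using deg
      by (intro sum.mono_neutral_cong_left) (auto simp: coeff_eq_0 mult.commute)
    finally show ?thesis .
  qed
  show "\<exists>a. \<forall>s. (\<Prod>b\<in>Basis. ((x + s *\<^sub>R v) \<bullet> b) ^ \<alpha> b) *\<^sub>R c = (\<Sum>i\<le>r. s ^ i *\<^sub>R a i)"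
    by (intro exI[of _ "\<lambda>i. coeff P i *\<^sub>R c"]) (simp add: val scaleR_sum_left)
qed

lemma finite_multi_indices:
  "finite {\<alpha> :: 'a::euclidean_space \<Rightarrow> nat. (\<forall>b. b \<notin> Basis \<longrightarrow> \<alpha> b = 0) \<and> (\<Sum>b\<in>Basis. \<alpha> b) \<le> r}"
proof (rule finite_subset)
  show "{\<alpha> :: 'a \<Rightarrow> nat. (\<forall>b. b \<notin> Basis \<longrightarrow> \<alpha> b = 0) \<and> (\<Sum>b\<in>Basis. \<alpha> b) \<le> r}
    \<subseteq> {\<alpha>. (\<forall>b. (b \<in> Basis \<longrightarrow> \<alpha> b \<in> {..r}) \<and> (b \<notin> Basis \<longrightarrow> \<alpha> b = 0))}"
  proof (clarify, intro conjI impI)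
    fix \<alpha> :: "'a \<Rightarrow> nat" and b :: 'a
    assume "(\<Sum>b\<in>Basis. \<alpha> b) \<le> r" "b \<in> Basis"
    then show "\<alpha> b \<in> {..r}"
      using member_le_sum[of b Basis \<alpha>] by simp
  qed blast
qed (rule finite_set_of_finite_funs, auto)

lemma
  assumes "poly_deg_le r p"
  shows poly_deg_le_imp_poly_on_lines: "poly_on_lines r p"
    and poly_deg_le_imp_continuous: "continuous_on UNIV p"
proof -
  obtain c where p: "p = (\<lambda>x. \<Sum>\<alpha> | (\<forall>b. b \<notin> Basis \<longrightarrow> \<alpha> b = (0::nat)) \<and> (\<Sum>b\<in>Basis. \<alpha> b) \<le> r.
           (\<Prod>b\<in>Basis. (x \<bullet> b) ^ \<alpha> b) *\<^sub>R c \<alpha>)"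
    using assms unfolding poly_deg_le_def by blast
  show "poly_on_lines r p"
    unfolding p by (intro poly_on_lines_sum finite_multi_indices poly_on_lines_monomial) auto
  show "continuous_on UNIV p"
    unfolding p by (intro continuous_on_sum continuous_on_scaleR continuous_on_prod continuous_on_power
        continuous_on_inner continuous_on_id continuous_on_const)
qed

text \<open>
  Both sides have degree at most \<open>r\<close> and agree at the \<open>r + 1\<close> nodes; \<open>l s\<close> is the Lagrange basis
  polynomial of the node \<open>s\<close>.
\<close>

lemma lagrange_interpolation:
  fixes S :: "real set"
  assumes "finite S" "card S = Suc r"
  obtains l where "\<And>i. i \<le> r \<Longrightarrow> monom 1 i = (\<Sum>s\<in>S. smult (s ^ i) (l s))"
proof
  define l where "l s = (\<Prod>t\<in>S - {s}. smult (1 / (s - t)) [:- t, 1:])" for s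
  have deg: "degree (l s) \<le> r" if "s \<in> S" for s
  proof -
    have "degree (l s) \<le> (\<Sum>t\<in>S - {s}. degree (smult (1 / (s - t)) [:- t, 1:]))"
      unfolding l_def by (rule degree_prod_sum_le[unfolded o_def]) (use assms in simp)
    also have "\<dots> \<le> (\<Sum>t\<in>S - {s}. 1)" by (intro sum_mono) auto
    finally show ?thesis using that assms by simp
  qed
  have val: "poly (l s) x = (if s = x then 1 else 0)" if "s \<in> S" "x \<in> S" for s x
    using that assms by (auto simp: l_def poly_prod diff_divide_distrib[symmetric] intro!: prod.neutral)
  fix i assume i: "i \<le> r"
  show "monom 1 i = (\<Sum>s\<in>S. smult (s ^ i) (l s))"
  proof (rule poly_eqI_degree)
    show "poly (monom 1 i) x = poly (\<Sum>s\<in>S. smult (s ^ i) (l s)) x" if "x \<in> S" for x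
    proof -
      have "poly (\<Sum>s\<in>S. smult (s ^ i) (l s)) x = (\<Sum>s\<in>S. s ^ i * poly (l s) x)"
        by (simp add: poly_sum)
      also have "\<dots> = (\<Sum>s\<in>S. if s = x then s ^ i else 0)"
        by (intro sum.cong) (use that in \<open>auto simp: val\<close>)
      finally show ?thesis using that assms by (simp add: poly_monom)
    qed
    show "card S > degree (monom (1::real) i)" using i assms by (simp add: degree_monom_eq)
    have "degree (\<Sum>s\<in>S. smult (s ^ i) (l s)) \<le> r"
      by (intro degree_sum_le) (use assms deg in \<open>auto intro: order_trans[OF degree_smult_le]\<close>)
    then show "card S > degree (\<Sum>s\<in>S. smult (s ^ i) (l s))" using assms by simp
  qed
qed

text \<open>
  Evaluation at any \<open>l\<close> and differentiation at \<open>0\<close> are combinations of the values at nodes that do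
  not depend on the polynomial: apply these functionals to the Lagrange interpolation formula. The
  nodes lie in \<open>(0, 1]\<close> because samples of a polynomial at \<open>c + s v\<close> must then stay within any ball
  around \<open>c\<close> that contains \<open>c + v\<close>.
\<close>

lemma sampling_nodes:
  obtains S :: "real set" and w :: "real \<Rightarrow> real \<Rightarrow> real" and w' :: "real \<Rightarrow> real"
  where "finite S" "S \<subseteq> {0<..1}"
    and "\<And>l i. i \<le> r \<Longrightarrow> (\<Sum>s\<in>S. w l s * s ^ i) = l ^ i"
    and "\<And>i. i \<le> r \<Longrightarrow> (\<Sum>s\<in>S. w' s * s ^ i) = (if i = 1 then 1 else 0)"
proof -
  have "infinite {0<..1::real}" by simp
  then obtain S where S: "finite S" "card S = Suc r" "S \<subseteq> {0<..1::real}"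
    using infinite_arbitrarily_large by blast
  obtain l where l: "\<And>i. i \<le> r \<Longrightarrow> monom 1 i = (\<Sum>s\<in>S. smult (s ^ i) (l s))"
    using lagrange_interpolation[OF S(1,2)] by blast
  have "(\<Sum>s\<in>S. poly (l s) x * s ^ i) = x ^ i" if "i \<le> r" for x i
    using arg_cong[OF l[OF that], of "\<lambda>q. poly q x"] by (simp add: poly_sum poly_monom mult.commute)
  moreover have "(\<Sum>s\<in>S. coeff (l s) 1 * s ^ i) = (if i = 1 then 1 else 0)" if "i \<le> r" for i
    using arg_cong[OF l[OF that], of "\<lambda>q. coeff q 1"] by (simp add: coeff_sum mult.commute)
  ultimately show ?thesis using that[of S "\<lambda>x s. poly (l s) x" "\<lambda>s. coeff (l s) 1"] S by blast
qed

lemma poly_on_lines_extrapolate: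
  assumes "\<And>i. i \<le> r \<Longrightarrow> (\<Sum>s\<in>S. w s * s ^ i) = l ^ i" "poly_on_lines r p"
  shows "p (x + l *\<^sub>R v) = (\<Sum>s\<in>S. w s *\<^sub>R p (x + s *\<^sub>R v))"
proof -
  obtain a where a: "\<And>s. p (x + s *\<^sub>R v) = (\<Sum>i\<le>r. s ^ i *\<^sub>R a i)"
    using assms(2) unfolding poly_on_lines_def by blast
  have "(\<Sum>s\<in>S. w s *\<^sub>R p (x + s *\<^sub>R v)) = (\<Sum>s\<in>S. \<Sum>i\<le>r. (w s * s ^ i) *\<^sub>R a i)"
    by (simp add: a scaleR_sum_right)
  also have "\<dots> = (\<Sum>i\<le>r. (\<Sum>s\<in>S. w s * s ^ i) *\<^sub>R a i)"
    unfolding scaleR_sum_left by (rule sum.swap)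
  also have "\<dots> = (\<Sum>i\<le>r. l ^ i *\<^sub>R a i)"
    by (intro sum.cong) (simp_all add: assms(1))
  finally show ?thesis unfolding a[of l] by simp
qed

definition dir_deriv :: "'a::real_vector \<Rightarrow> ('a \<Rightarrow> 'b::real_normed_vector) \<Rightarrow> 'a \<Rightarrow> 'b" where
  "dir_deriv b p x = vector_derivative (\<lambda>s. p (x + s *\<^sub>R b)) (at 0)"

lemma has_dir_deriv:
  assumes "poly_on_lines r p"
  shows "((\<lambda>s. p (x + s *\<^sub>R b)) has_vector_derivative dir_deriv b p x) (at 0)"
proof -
  obtain a where a: "\<And>s. p (x + s *\<^sub>R b) = (\<Sum>i\<le>r. s ^ i *\<^sub>R a i)"
    using assms unfolding poly_on_lines_def by blast
  have "((\<lambda>s. p (x + s *\<^sub>R b)) has_vector_derivative (\<Sum>i\<le>r. (real i * 0 ^ (i - 1)) *\<^sub>R a i)) (at 0)"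
    unfolding a by (auto intro!: derivative_eq_intros)
  then show ?thesis
    unfolding dir_deriv_def by (rule vector_derivative_works[THEN iffD1, OF differentiableI_vector])
qed

text \<open>
  Applying the differentiation rule on the line with direction \<open>\<eta> b\<close> gives a difference quotient with
  step \<open>\<eta>\<close> that is exact on polynomials. The freedom in \<open>\<eta>\<close> is what makes the resulting inverse estimate
  scale correctly with the element diameter.
\<close>

lemma dir_deriv_formula:
  assumes w: "\<And>i. i \<le> r \<Longrightarrow> (\<Sum>s\<in>S. w s * s ^ i) = (if i = 1 then 1 else 0)"
    and p: "poly_on_lines r p" and \<eta>: "\<eta> \<noteq> 0"
  shows "dir_deriv b p x = (1 / \<eta>) *\<^sub>R (\<Sum>s\<in>S. w s *\<^sub>R p (x + s *\<^sub>R \<eta> *\<^sub>R b))"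
proof -
  obtain a where a: "\<And>s. p (x + s *\<^sub>R b) = (\<Sum>i\<le>r. s ^ i *\<^sub>R a i)"
    using p unfolding poly_on_lines_def by blast
  define d where "d = (\<Sum>i\<le>r. (if i = 1 then 1 else 0) *\<^sub>R a i)"
  have "((\<lambda>s. p (x + s *\<^sub>R b)) has_vector_derivative (\<Sum>i\<le>r. (real i * 0 ^ (i - 1)) *\<^sub>R a i)) (at 0)"
    unfolding a by (auto intro!: derivative_eq_intros)
  also have "(\<Sum>i\<le>r. (real i * 0 ^ (i - 1)) *\<^sub>R a i) = d"
    unfolding d_def by (intro sum.cong) (auto simp: power_0_left)
  finally have d: "dir_deriv b p x = d"
    unfolding dir_deriv_def by (rule vector_derivative_at)
  have "(\<Sum>s\<in>S. w s *\<^sub>R p (x + s *\<^sub>R \<eta> *\<^sub>R b)) = (\<Sum>s\<in>S. w s *\<^sub>R p (x + (s * \<eta>) *\<^sub>R b))"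
    by simp
  also have "\<dots> = (\<Sum>s\<in>S. \<Sum>i\<le>r. (w s * s ^ i) *\<^sub>R \<eta> ^ i *\<^sub>R a i)"
    by (simp add: a scaleR_sum_right power_mult_distrib mult.assoc)
  also have "\<dots> = (\<Sum>i\<le>r. (\<Sum>s\<in>S. w s * s ^ i) *\<^sub>R \<eta> ^ i *\<^sub>R a i)"
    unfolding scaleR_sum_left by (rule sum.swap)
  also have "\<dots> = (\<Sum>i\<le>r. if i = 1 then \<eta> *\<^sub>R a i else 0)"
    by (intro sum.cong) (auto simp: w)
  also have "\<dots> = \<eta> *\<^sub>R d"
    unfolding d_def scaleR_sum_right by (intro sum.cong) auto
  finally show "dir_deriv b p x = (1 / \<eta>) *\<^sub>R (\<Sum>s\<in>S. w s *\<^sub>R p (x + s *\<^sub>R \<eta> *\<^sub>R b))"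
    using d \<eta> by simp
qed

lemma dir_deriv_poly_on_lines:
  fixes p :: "'a::real_normed_vector \<Rightarrow> 'b::real_normed_vector"
  assumes p: "poly_on_lines r p" "continuous_on UNIV p"
  shows "poly_on_lines r (dir_deriv b p)" "continuous_on UNIV (dir_deriv b p)"
    "((\<lambda>s. p (x + s *\<^sub>R b)) has_vector_derivative dir_deriv b p x) (at 0)"
proof -
  obtain S u w where "finite S" "S \<subseteq> {0<..1}"
      "\<And>l i. i \<le> r \<Longrightarrow> (\<Sum>s\<in>S. u l s * s ^ i) = (l::real) ^ i"
    and w: "\<And>i. i \<le> r \<Longrightarrow> (\<Sum>s\<in>S. w s * s ^ i) = (if i = 1 then 1 else 0)"
    by (rule sampling_nodes[of r]) (rule that)
  have eq: "dir_deriv b p = (\<lambda>x. \<Sum>s\<in>S. w s *\<^sub>R p (x + s *\<^sub>R b))"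
    using dir_deriv_formula[OF w p(1), of 1] by (simp add: fun_eq_iff)
  show "poly_on_lines r (dir_deriv b p)"
    unfolding eq by (intro poly_on_lines_sum poly_on_lines_scaleR poly_on_lines_translate \<open>finite S\<close> p)
  have cont: "continuous_on UNIV (\<lambda>x. p (x + s *\<^sub>R b))" for s
    by (rule continuous_on_compose2[OF p(2)]) (auto intro!: continuous_intros)
  show "continuous_on UNIV (dir_deriv b p)"
    unfolding eq by (intro continuous_on_sum continuous_on_scaleR continuous_on_const cont)
  show "((\<lambda>s. p (x + s *\<^sub>R b)) has_vector_derivative dir_deriv b p x) (at 0)"
    by (rule has_dir_deriv[OF p(1)])
qed

section \<open>Inverse estimates on balls\<close>

lemma L2_norm_sq_alt:
  assumes "A \<in> sets lebesgue"
  shows "L2_norm_sq A f = (\<integral>\<^sup>+x. ennreal ((norm (f x))\<^sup>2) * indicator A x \<partial>lebesgue)"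
  unfolding L2_norm_sq_def by (subst nn_integral_restrict_space) (use assms in auto)

lemma L2_norm_sq_lborel:
  assumes "A \<in> sets borel"
  shows "L2_norm_sq A f = (\<integral>\<^sup>+x. ennreal ((norm (f x))\<^sup>2) * indicator A x \<partial>lborel)"
  using L2_norm_sq_alt[of A f] assms by (simp add: nn_integral_completion)

lemma L2_norm_sq_mono_set:
  assumes "A \<in> sets lebesgue" "B \<in> sets lebesgue" "A \<subseteq> B"
  shows "L2_norm_sq A f \<le> L2_norm_sq B f"
  unfolding L2_norm_sq_alt[OF assms(1)] L2_norm_sq_alt[OF assms(2)]
  by (intro nn_integral_mono mult_left_mono) (use assms(3) in \<open>auto simp: indicator_def\<close>)

lemma nn_integral_lborel_affine:
  fixes f :: "'a::euclidean_space \<Rightarrow> ennreal"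
  assumes [measurable]: "f \<in> borel_measurable borel" and "0 < l"
  shows "(\<integral>\<^sup>+x. f x \<partial>lborel) = ennreal (l ^ DIM('a)) * (\<integral>\<^sup>+y. f (c + l *\<^sub>R y) \<partial>lborel)"
  using assms(2)
  by (subst lborel_affine[of l c]) (simp_all add: nn_integral_density nn_integral_distr nn_integral_cmult)

lemma L2_norm_sq_ball_scale:
  fixes p :: "'a::euclidean_space \<Rightarrow> 'b::euclidean_space"
  assumes "continuous_on UNIV p" "0 < l"
  shows "L2_norm_sq (ball c (l * \<rho>)) p = ennreal (l ^ DIM('a)) * L2_norm_sq (ball 0 \<rho>) (\<lambda>y. p (c + l *\<^sub>R y))"
proof -
  have [measurable]: "p \<in> borel_measurable borel"
    using assms(1) by (rule borel_measurable_continuous_onI)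
  have [simp]: "(\<lambda>x. ennreal ((norm (p x))\<^sup>2) * indicator (ball a R) x) \<in> borel_measurable borel" for a R
  proof -
    have [measurable]: "ball a R \<in> sets borel" by simp
    show ?thesis by measurable
  qed
  have "indicator (ball c (l * \<rho>)) (c + l *\<^sub>R y) = (indicator (ball 0 \<rho>) y :: ennreal)" for y
    using assms(2) by (simp add: indicator_def dist_norm)
  then show ?thesis
    unfolding L2_norm_sq_lborel[OF borel_open[OF open_ball]]
    by (subst nn_integral_lborel_affine[OF _ assms(2), of _ c]) simp_all
qed

lemma L2_norm_sq_ball_translate:
  fixes p :: "'a::euclidean_space \<Rightarrow> 'b::euclidean_space"
  assumes "continuous_on UNIV p"
  shows "L2_norm_sq (ball c \<rho>) (\<lambda>x. p (x + v)) = L2_norm_sq (ball (c + v) \<rho>) p"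
proof -
  have [measurable]: "p \<in> borel_measurable borel"
    using assms(1) by (rule borel_measurable_continuous_onI)
  have [simp]: "(\<lambda>x. ennreal ((norm (p x))\<^sup>2) * indicator (ball a R) x) \<in> borel_measurable borel" for a R
  proof -
    have [measurable]: "ball a R \<in> sets borel" by simp
    show ?thesis by measurable
  qed
  have "indicator (ball (c + v) \<rho>) (v + y) = (indicator (ball c \<rho>) y :: ennreal)" for y
    by (simp add: indicator_def dist_norm add.commute)
  then show ?thesis
    unfolding L2_norm_sq_lborel[OF borel_open[OF open_ball]]
    by (subst (2) nn_integral_lborel_affine[of _ 1 v]) (simp_all add: add.commute)
qed

lemma norm_sum_scaleR_squared_le:
  fixes f :: "'i \<Rightarrow> 'b::real_normed_vector"
  shows "(norm (\<Sum>s\<in>S. w s *\<^sub>R f s))\<^sup>2 \<le> (\<Sum>s\<in>S. real (card S) * (w s)\<^sup>2 * (norm (f s))\<^sup>2)"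
proof -
  have "(norm (\<Sum>s\<in>S. w s *\<^sub>R f s))\<^sup>2 \<le> (\<Sum>s\<in>S. norm (w s *\<^sub>R f s))\<^sup>2"
    by (intro power_mono norm_sum) auto
  also have "\<dots> \<le> (\<Sum>s\<in>S. (norm (w s *\<^sub>R f s))\<^sup>2) * card S"
    by (rule sum_squared_le_sum_of_squares)
  also have "\<dots> = (\<Sum>s\<in>S. real (card S) * (w s)\<^sup>2 * (norm (f s))\<^sup>2)"
    by (simp add: sum_distrib_left sum_distrib_right power_mult_distrib mult_ac)
  finally show ?thesis .
qed

lemma L2_norm_sq_sum_le:
  fixes f :: "'i \<Rightarrow> 'a::euclidean_space \<Rightarrow> 'b::euclidean_space"
  assumes f: "\<And>s. s \<in> S \<Longrightarrow> continuous_on UNIV (f s)"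
    and le: "\<And>s. s \<in> S \<Longrightarrow> L2_norm_sq (ball c \<rho>) (f s) \<le> ennreal (k s) * N"
    and k: "\<And>s. s \<in> S \<Longrightarrow> 0 \<le> k s"
  shows "L2_norm_sq (ball c \<rho>) (\<lambda>x. \<Sum>s\<in>S. w s *\<^sub>R f s x)
    \<le> ennreal (\<Sum>s\<in>S. real (card S) * (w s)\<^sup>2 * k s) * N"
proof -
  have meas: "(\<lambda>x. ennreal ((norm (f s x))\<^sup>2) * indicator (ball c \<rho>) x) \<in> borel_measurable lborel"
    if "s \<in> S" for s
  proof -
    have [measurable]: "f s \<in> borel_measurable borel"
      using f[OF that] by (rule borel_measurable_continuous_onI)
    have [measurable]: "ball c \<rho> \<in> sets borel" by simp
    show ?thesis by measurable
  qed
  have "L2_norm_sq (ball c \<rho>) (\<lambda>x. \<Sum>s\<in>S. w s *\<^sub>R f s x)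
    \<le> (\<integral>\<^sup>+x. (\<Sum>s\<in>S. ennreal (real (card S) * (w s)\<^sup>2) * (ennreal ((norm (f s x))\<^sup>2) * indicator (ball c \<rho>) x)) \<partial>lborel)"
    unfolding L2_norm_sq_lborel[OF borel_open[OF open_ball]]
  proof (rule nn_integral_mono)
    fix x
    have "ennreal ((norm (\<Sum>s\<in>S. w s *\<^sub>R f s x))\<^sup>2) \<le> ennreal (\<Sum>s\<in>S. real (card S) * (w s)\<^sup>2 * (norm (f s x))\<^sup>2)"
      by (intro ennreal_leI norm_sum_scaleR_squared_le)
    then show "ennreal ((norm (\<Sum>s\<in>S. w s *\<^sub>R f s x))\<^sup>2) * indicator (ball c \<rho>) x
      \<le> (\<Sum>s\<in>S. ennreal (real (card S) * (w s)\<^sup>2) * (ennreal ((norm (f s x))\<^sup>2) * indicator (ball c \<rho>) x))"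
      by (auto simp: indicator_def ennreal_mult'[symmetric] sum_ennreal)
  qed
  also have "\<dots> = (\<Sum>s\<in>S. ennreal (real (card S) * (w s)\<^sup>2) * L2_norm_sq (ball c \<rho>) (f s))"
    unfolding L2_norm_sq_lborel[OF borel_open[OF open_ball]]
    proof (subst nn_integral_sum)
    show "(\<lambda>x. ennreal (real (card S) * (w s)\<^sup>2) * (ennreal ((norm (f s x))\<^sup>2) * indicator (ball c \<rho>) x))
        \<in> borel_measurable lborel" if "s \<in> S" for s
      by (rule borel_measurable_times_ennreal[OF borel_measurable_const meas[OF that]])
  qed (intro sum.cong refl nn_integral_cmult meas)
  also have "\<dots> \<le> (\<Sum>s\<in>S. ennreal (real (card S) * (w s)\<^sup>2) * (ennreal (k s) * N))"
    by (intro sum_mono mult_left_mono le) auto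
  also have "\<dots> = (\<Sum>s\<in>S. ennreal (real (card S) * (w s)\<^sup>2 * k s) * N)"
    by (intro sum.cong refl) (simp add: ennreal_mult k mult.assoc)
  also have "\<dots> = ennreal (\<Sum>s\<in>S. real (card S) * (w s)\<^sup>2 * k s) * N"
    by (simp add: sum_distrib_right[symmetric] sum_ennreal k)
  finally show ?thesis .
qed

text \<open>
  On the ball of radius \<open>l \<rho>\<close> the value of \<open>p\<close> at \<open>c + l y\<close> is a fixed combination of the values at
  \<open>c + s y\<close> with \<open>0 < s \<le> 1\<close>, and these points lie in the ball of radius \<open>\<rho>\<close>. This replaces the
  usual compactness argument for the equivalence of norms on a finite-dimensional space.
\<close>

lemma L2_norm_sq_ball_extrapolate:
  fixes l :: real
  assumes "0 < l"
  shows "\<exists>K\<ge>0. \<forall>(p :: 'a::euclidean_space \<Rightarrow> 'b::euclidean_space) c \<rho>.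
    poly_on_lines r p \<longrightarrow> continuous_on UNIV p \<longrightarrow> 0 \<le> \<rho> \<longrightarrow>
    L2_norm_sq (ball c (l * \<rho>)) p \<le> ennreal K * L2_norm_sq (ball c \<rho>) p"
proof -
  obtain S u w where S: "finite S" "S \<subseteq> {0<..1}"
    and u: "\<And>l i. i \<le> r \<Longrightarrow> (\<Sum>s\<in>S. u l s * s ^ i) = (l::real) ^ i"
    and w: "\<And>i. i \<le> r \<Longrightarrow> (\<Sum>s\<in>S. w s * s ^ i) = (if i = 1 then 1 else (0::real))"
    by (rule sampling_nodes[of r]) (rule that)
  \<comment> \<open>The substitution \<open>y \<mapsto> c + s y\<close> contributes the inverse of its Jacobian determinant.\<close>
  define k where "k s = 1 / s ^ DIM('a)" for s :: real
  have k: "0 \<le> k s" if "s \<in> S" for s using that S by (auto simp: k_def)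
  define K where "K = l ^ DIM('a) * (\<Sum>s\<in>S. real (card S) * (u l s)\<^sup>2 * k s)"
  show ?thesis
  proof (intro exI[of _ K] conjI allI impI)
    show "0 \<le> K" unfolding K_def using assms k by (intro mult_nonneg_nonneg sum_nonneg) auto
    fix p :: "'a \<Rightarrow> 'b" and c \<rho>
    assume p: "poly_on_lines r p" "continuous_on UNIV p" and \<rho>: "(0::real) \<le> \<rho>"
    have le: "L2_norm_sq (ball 0 \<rho>) (\<lambda>y. p (c + s *\<^sub>R y)) \<le> ennreal (k s) * L2_norm_sq (ball c \<rho>) p"
      if "s \<in> S" for s
    proof -
      have s: "0 < s" "s \<le> 1" using that S by auto
      have "ennreal (k s) * L2_norm_sq (ball c (s * \<rho>)) p
          = ennreal (k s * s ^ DIM('a)) * L2_norm_sq (ball 0 \<rho>) (\<lambda>y. p (c + s *\<^sub>R y))"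
        using k[OF that] s by (simp add: L2_norm_sq_ball_scale[OF p(2) s(1)] ennreal_mult mult.assoc)
      then have "L2_norm_sq (ball 0 \<rho>) (\<lambda>y. p (c + s *\<^sub>R y)) = ennreal (k s) * L2_norm_sq (ball c (s * \<rho>)) p"
        using s by (simp add: k_def)
      also have "\<dots> \<le> ennreal (k s) * L2_norm_sq (ball c \<rho>) p"
        using s \<rho> by (intro mult_left_mono L2_norm_sq_mono_set subset_ball mult_left_le_one_le) auto
      finally show ?thesis .
    qed
    have cont: "continuous_on UNIV (\<lambda>y. p (c + s *\<^sub>R y))" for s
      by (rule continuous_on_compose2[OF p(2)]) (auto intro!: continuous_intros)
    have eq: "p (c + l *\<^sub>R y) = (\<Sum>s\<in>S. u l s *\<^sub>R p (c + s *\<^sub>R y))" for y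
      by (rule poly_on_lines_extrapolate[OF u p(1)])
    have "L2_norm_sq (ball c (l * \<rho>)) p
        = ennreal (l ^ DIM('a)) * L2_norm_sq (ball 0 \<rho>) (\<lambda>y. \<Sum>s\<in>S. u l s *\<^sub>R p (c + s *\<^sub>R y))"
      by (simp only: L2_norm_sq_ball_scale[OF p(2) assms] eq)
    also have "\<dots> \<le> ennreal (l ^ DIM('a)) *
        (ennreal (\<Sum>s\<in>S. real (card S) * (u l s)\<^sup>2 * k s) * L2_norm_sq (ball c \<rho>) p)"
      by (intro mult_left_mono L2_norm_sq_sum_le cont le k) auto
    also have "\<dots> = ennreal K * L2_norm_sq (ball c \<rho>) p"
      unfolding K_def using assms k
      by (subst ennreal_mult) (auto intro!: sum_nonneg simp: mult.assoc)
    finally show "L2_norm_sq (ball c (l * \<rho>)) p \<le> ennreal K * L2_norm_sq (ball c \<rho>) p" .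
  qed
qed

text \<open>
  The derivative is a combination of translates of \<open>p\<close> by vectors of length at most \<open>\<eta>\<close>, with
  coefficients of size \<open>1 / \<eta>\<close>; hence the factor \<open>1 / \<eta>\<^sup>2\<close> and the larger ball.
\<close>

lemma L2_norm_sq_ball_dir_deriv:
  "\<exists>K\<ge>0. \<forall>(p :: 'a::euclidean_space \<Rightarrow> 'b::euclidean_space) b c (\<rho>::real) (\<eta>::real).
    poly_on_lines r p \<longrightarrow> continuous_on UNIV p \<longrightarrow> norm b \<le> 1 \<longrightarrow> 0 < \<eta> \<longrightarrow>
    L2_norm_sq (ball c \<rho>) (dir_deriv b p) \<le> ennreal (K / \<eta>\<^sup>2) * L2_norm_sq (ball c (\<rho> + \<eta>)) p"
proof -
  obtain S u w where S: "finite S" "S \<subseteq> {0<..1}"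
    and u: "\<And>l i. i \<le> r \<Longrightarrow> (\<Sum>s\<in>S. u l s * s ^ i) = (l::real) ^ i"
    and w: "\<And>i. i \<le> r \<Longrightarrow> (\<Sum>s\<in>S. w s * s ^ i) = (if i = 1 then 1 else (0::real))"
    by (rule sampling_nodes[of r]) (rule that)
  define K where "K = (\<Sum>s\<in>S. real (card S) * (w s)\<^sup>2)"
  show ?thesis
  proof (intro exI[of _ K] conjI allI impI)
    show "0 \<le> K" unfolding K_def by (intro sum_nonneg) auto
    fix p :: "'a \<Rightarrow> 'b" and b c :: 'a and \<rho> \<eta> :: real
    assume p: "poly_on_lines r p" "continuous_on UNIV p" and b: "norm b \<le> 1" and \<eta>: "0 < \<eta>"
    have cont: "continuous_on UNIV (\<lambda>x. p (x + s *\<^sub>R \<eta> *\<^sub>R b))" for s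
      by (rule continuous_on_compose2[OF p(2)]) (auto intro!: continuous_intros)
    have le: "L2_norm_sq (ball c \<rho>) (\<lambda>x. p (x + s *\<^sub>R \<eta> *\<^sub>R b)) \<le> ennreal 1 * L2_norm_sq (ball c (\<rho> + \<eta>)) p"
      if "s \<in> S" for s
    proof -
      have s: "0 < s" "s \<le> 1" using that S by auto
      have "norm (s *\<^sub>R \<eta> *\<^sub>R b) = s * \<eta> * norm b" using s \<eta> by simp
      also have "\<dots> \<le> 1 * \<eta> * 1" using s \<eta> b by (intro mult_mono) auto
      finally have "ball (c + s *\<^sub>R \<eta> *\<^sub>R b) \<rho> \<subseteq> ball c (\<rho> + \<eta>)"
        by (simp add: ball_subset_ball_iff dist_norm)
      then show ?thesis
        by (simp add: L2_norm_sq_ball_translate[OF p(2)] L2_norm_sq_mono_set)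
    qed
    have eq: "dir_deriv b p = (\<lambda>x. \<Sum>s\<in>S. (w s / \<eta>) *\<^sub>R p (x + s *\<^sub>R \<eta> *\<^sub>R b))"
      using dir_deriv_formula[OF w p(1), of \<eta> b] \<eta> by (simp add: fun_eq_iff scaleR_sum_right)
    have "(\<Sum>s\<in>S. real (card S) * (w s / \<eta>)\<^sup>2 * 1) = K / \<eta>\<^sup>2"
      by (simp add: K_def power_divide sum_divide_distrib)
    moreover have "L2_norm_sq (ball c \<rho>) (dir_deriv b p)
       \<le> ennreal (\<Sum>s\<in>S. real (card S) * (w s / \<eta>)\<^sup>2 * 1) * L2_norm_sq (ball c (\<rho> + \<eta>)) p"
      unfolding eq by (intro L2_norm_sq_sum_le cont le) auto
    ultimately show "L2_norm_sq (ball c \<rho>) (dir_deriv b p) \<le> ennreal (K / \<eta>\<^sup>2) * L2_norm_sq (ball c (\<rho> + \<eta>)) p"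
      by simp
  qed
qed

text \<open>
  The head of the list is differentiated first, whereas \<^const>\<open>pderivs\<close> differentiates along the head
  last. This reversal is what integration by parts produces when it moves one derivative at a time
  from the test function to the polynomial.
\<close>
abbreviation dir_derivs :: "'a::real_vector list \<Rightarrow> ('a \<Rightarrow> 'b::real_normed_vector) \<Rightarrow> 'a \<Rightarrow> 'b" where
  "dir_derivs \<equiv> fold dir_deriv"

lemma dir_derivs_poly_on_lines:
  fixes p :: "'a::real_normed_vector \<Rightarrow> 'b::real_normed_vector"
  assumes "poly_on_lines r p" "continuous_on UNIV p"
  shows "poly_on_lines r (dir_derivs bs p)" "continuous_on UNIV (dir_derivs bs p)"
proof -
  have "poly_on_lines r (dir_derivs bs p) \<and> continuous_on UNIV (dir_derivs bs p)"
    using assms by (induction bs arbitrary: p) (auto intro: dir_deriv_poly_on_lines)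
  then show "poly_on_lines r (dir_derivs bs p)" "continuous_on UNIV (dir_derivs bs p)" by auto
qed

lemma L2_norm_sq_ball_dir_derivs:
  "\<exists>K\<ge>0. \<forall>(p :: 'a::euclidean_space \<Rightarrow> 'b::euclidean_space) bs c (\<rho>::real) (\<eta>::real).
    poly_on_lines r p \<longrightarrow> continuous_on UNIV p \<longrightarrow> set bs \<subseteq> Basis \<longrightarrow> 0 < \<eta> \<longrightarrow>
    L2_norm_sq (ball c \<rho>) (dir_derivs bs p)
      \<le> ennreal ((K / \<eta>\<^sup>2) ^ length bs) * L2_norm_sq (ball c (\<rho> + length bs * \<eta>)) p"
proof -
  obtain K where K: "K \<ge> 0" and step: "\<And>(p :: 'a \<Rightarrow> 'b) b c (\<rho>::real) (\<eta>::real).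
    \<lbrakk>poly_on_lines r p; continuous_on UNIV p; norm b \<le> 1; 0 < \<eta>\<rbrakk> \<Longrightarrow>
    L2_norm_sq (ball c \<rho>) (dir_deriv b p) \<le> ennreal (K / \<eta>\<^sup>2) * L2_norm_sq (ball c (\<rho> + \<eta>)) p"
    using L2_norm_sq_ball_dir_deriv[of r, where 'a='a and 'b='b] by blast
  show ?thesis
  proof (intro exI[of _ K] conjI allI impI)
    fix p :: "'a \<Rightarrow> 'b" and bs :: "'a list" and c and \<rho> \<eta> :: real
    assume "poly_on_lines r p" "continuous_on UNIV p" "set bs \<subseteq> Basis" "0 < \<eta>"
    then show "L2_norm_sq (ball c \<rho>) (dir_derivs bs p)
      \<le> ennreal ((K / \<eta>\<^sup>2) ^ length bs) * L2_norm_sq (ball c (\<rho> + length bs * \<eta>)) p"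
    proof (induction bs arbitrary: p)
      case (Cons b bs)
      let ?R = "\<rho> + length bs * \<eta>"
      have "L2_norm_sq (ball c \<rho>) (dir_derivs (b # bs) p)
          \<le> ennreal ((K / \<eta>\<^sup>2) ^ length bs) * L2_norm_sq (ball c ?R) (dir_deriv b p)"
        using Cons.IH[of "dir_deriv b p"] Cons.prems by (simp add: dir_deriv_poly_on_lines[OF Cons.prems(1,2)])
      also have "\<dots> \<le> ennreal ((K / \<eta>\<^sup>2) ^ length bs) * (ennreal (K / \<eta>\<^sup>2) * L2_norm_sq (ball c (?R + \<eta>)) p)"
        using Cons.prems by (intro mult_left_mono step) auto
      also have "\<dots> = ennreal ((K / \<eta>\<^sup>2) ^ length (b # bs)) * L2_norm_sq (ball c (\<rho> + length (b # bs) * \<eta>)) p"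
        using K by (simp add: ennreal_mult[symmetric] mult.assoc[symmetric] algebra_simps)
      finally show ?case .
    qed simp
  qed (rule K)
qed

text \<open>
  The two balls will be an enclosing and an inscribed ball of an element of diameter \<open>d\<close>. With step
  \<open>\<eta> = d\<close>, taking \<open>m\<close> derivatives enlarges the radius \<open>2 d\<close> to \<open>(2 + m) d\<close>, and extrapolation by
  the factor \<open>(2 + m) \<gamma>\<close> returns to the inscribed ball; neither factor involves \<open>d\<close>.
\<close>

lemma inverse_estimate_balls:
  assumes "0 < \<gamma>"
  shows "\<exists>K\<ge>0. \<forall>(p :: 'a::euclidean_space \<Rightarrow> 'b::euclidean_space) bs c d.
    poly_on_lines r p \<longrightarrow> continuous_on UNIV p \<longrightarrow> set bs \<subseteq> Basis \<longrightarrow> length bs = m \<longrightarrow> 0 < d \<longrightarrow>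
    ennreal (d ^ (2 * m)) * L2_norm_sq (ball c (2 * d)) (dir_derivs bs p) \<le> ennreal K * L2_norm_sq (ball c (d / \<gamma>)) p"
proof -
  define l where "l = (2 + real m) * \<gamma>"
  have l: "0 < l" using assms by (simp add: l_def add_pos_nonneg)
  obtain K1 where K1: "K1 \<ge> 0" and 1: "\<And>(p :: 'a \<Rightarrow> 'b) bs c (\<rho>::real) (\<eta>::real).
    \<lbrakk>poly_on_lines r p; continuous_on UNIV p; set bs \<subseteq> Basis; 0 < \<eta>\<rbrakk> \<Longrightarrow>
    L2_norm_sq (ball c \<rho>) (dir_derivs bs p)
      \<le> ennreal ((K1 / \<eta>\<^sup>2) ^ length bs) * L2_norm_sq (ball c (\<rho> + length bs * \<eta>)) p"
    using L2_norm_sq_ball_dir_derivs[of r, where 'a='a and 'b='b] by blast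
  obtain K2 where K2: "K2 \<ge> 0" and 2: "\<And>(p :: 'a \<Rightarrow> 'b) c \<rho>.
    \<lbrakk>poly_on_lines r p; continuous_on UNIV p; 0 \<le> \<rho>\<rbrakk> \<Longrightarrow>
    L2_norm_sq (ball c (l * \<rho>)) p \<le> ennreal K2 * L2_norm_sq (ball c \<rho>) p"
    using L2_norm_sq_ball_extrapolate[OF l, of r, where 'a='a and 'b='b] by blast
  show ?thesis
  proof (intro exI[of _ "K1 ^ m * K2"] conjI allI impI)
    show "0 \<le> K1 ^ m * K2" using K1 K2 by simp
    fix p :: "'a \<Rightarrow> 'b" and bs :: "'a list" and c and d :: real
    assume p: "poly_on_lines r p" "continuous_on UNIV p" and bs: "set bs \<subseteq> Basis" "length bs = m" and d: "0 < d"
    have "2 * d + m * d = l * (d / \<gamma>)" using assms by (simp add: l_def algebra_simps)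
    then have "L2_norm_sq (ball c (2 * d)) (dir_derivs bs p)
        \<le> ennreal ((K1 / d\<^sup>2) ^ m) * L2_norm_sq (ball c (l * (d / \<gamma>))) p"
      using 1[OF p bs(1) d, of c "2 * d"] bs(2) by simp
    also have "\<dots> \<le> ennreal ((K1 / d\<^sup>2) ^ m) * (ennreal K2 * L2_norm_sq (ball c (d / \<gamma>)) p)"
      using d assms by (intro mult_left_mono 2 p) auto
    finally have "ennreal (d ^ (2 * m)) * L2_norm_sq (ball c (2 * d)) (dir_derivs bs p)
      \<le> ennreal (d ^ (2 * m)) * (ennreal ((K1 / d\<^sup>2) ^ m) * (ennreal K2 * L2_norm_sq (ball c (d / \<gamma>)) p))"
      by (rule mult_left_mono) auto
    also have "\<dots> = ennreal (d ^ (2 * m) * (K1 / d\<^sup>2) ^ m * K2) * L2_norm_sq (ball c (d / \<gamma>)) p"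
      using d K1 K2 by (simp add: ennreal_mult mult.assoc)
    also have "d ^ (2 * m) * (K1 / d\<^sup>2) ^ m * K2 = K1 ^ m * K2"
      using d by (simp add: power_divide power_mult)
    finally show "ennreal (d ^ (2 * m)) * L2_norm_sq (ball c (2 * d)) (dir_derivs bs p)
      \<le> ennreal (K1 ^ m * K2) * L2_norm_sq (ball c (d / \<gamma>)) p" .
  qed
qed

section \<open>Weak derivatives of piecewise polynomials\<close>

lemma integrable_lborel_compact_support:
  fixes g :: "'a::euclidean_space \<Rightarrow> 'b::euclidean_space"
  assumes "continuous_on UNIV g" "compact K" "\<And>x. x \<notin> K \<Longrightarrow> g x = 0"
  shows "integrable lborel g"
proof -
  have "integrable lborel (\<lambda>x. indicator K x *\<^sub>R g x)"
    using assms by (intro borel_integrable_compact) (auto intro: continuous_on_subset)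
  also have "(\<lambda>x. indicator K x *\<^sub>R g x) = g"
    using assms(3) by (auto simp: indicator_def fun_eq_iff)
  finally show ?thesis .
qed

text \<open>
  By translation invariance the difference quotients of \<open>g\<close> have integral zero, and they converge
  boundedly to \<open>g'\<close> inside a common ball, so dominated convergence applies.
\<close>

lemma integral_dir_deriv_compact_support:
  fixes g g' :: "'a::euclidean_space \<Rightarrow> 'b::euclidean_space"
  assumes g: "continuous_on UNIV g" and g': "continuous_on UNIV g'"
    and deriv: "\<And>x. ((\<lambda>s. g (x + s *\<^sub>R b)) has_vector_derivative g' x) (at 0)"
    and K: "compact K" and supp: "\<And>x. x \<notin> K \<Longrightarrow> g x = 0" "\<And>x. x \<notin> K \<Longrightarrow> g' x = 0"
  shows "integral\<^sup>L lborel g' = 0"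
proof -
  obtain R where R: "\<And>x. x \<in> K \<Longrightarrow> norm x \<le> R"
    using compact_imp_bounded[OF K] unfolding bounded_iff by auto
  have "compact (g' ` K)"
    using K g' by (intro compact_continuous_image) (auto intro: continuous_on_subset)
  then obtain B0 where B0: "\<And>x. x \<in> K \<Longrightarrow> norm (g' x) \<le> B0"
    using compact_imp_bounded[of "g' ` K"] unfolding bounded_iff by auto
  define B where "B = max B0 0"
  have B: "norm (g' x) \<le> B" for x
    using B0[of x] supp(2)[of x] by (cases "x \<in> K") (auto simp: B_def)
  define h where "h n = 1 / real (Suc n)" for n
  have h: "0 < h n" "h n \<le> 1" for n by (auto simp: h_def)
  define q where "q n x = (1 / h n) *\<^sub>R (g (x + h n *\<^sub>R b) - g x)" for n x
  have int_g: "integrable lborel g"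
    by (rule integrable_lborel_compact_support[OF g K supp(1)])
  have int_q: "integral\<^sup>L lborel (q n) = 0" for n
  proof -
    have meas: "(+) v \<in> measurable lborel borel" "g \<in> borel_measurable borel" for v :: 'a
      using g by (auto intro: borel_measurable_continuous_onI)
    have eq: "integrable lborel (\<lambda>x. g (v + x))" "(\<integral>x. g (v + x) \<partial>lborel) = integral\<^sup>L lborel g" for v
    proof -
      show "integrable lborel (\<lambda>x. g (v + x))"
        using int_g integrable_distr_eq[OF meas(1) meas(2), of v] by (simp add: lborel_distr_plus)
      show "(\<integral>x. g (v + x) \<partial>lborel) = integral\<^sup>L lborel g"
        using integral_distr[OF meas(1) meas(2), of v] by (simp add: lborel_distr_plus)
    qed
    show ?thesis
      unfolding q_def using eq[of "h n *\<^sub>R b"] int_g by (simp add: add.commute)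
  qed
  have lim: "(\<lambda>n. q n x) \<longlonglongrightarrow> g' x" for x
  proof -
    have "((\<lambda>s. norm (g (x + s *\<^sub>R b) - g x - s *\<^sub>R g' x) / norm s) \<longlongrightarrow> 0) (at 0)"
      using deriv[of x] unfolding has_vector_derivative_def has_derivative_at by simp
    moreover have "filterlim h (at 0) sequentially"
      unfolding filterlim_at using h LIMSEQ_inverse_real_of_nat
      by (auto simp: h_def[abs_def] inverse_eq_divide less_imp_neq[symmetric])
    ultimately have "(\<lambda>n. norm (g (x + h n *\<^sub>R b) - g x - h n *\<^sub>R g' x) / norm (h n)) \<longlonglongrightarrow> 0"
      by (rule filterlim_compose)
    also have "(\<lambda>n. norm (g (x + h n *\<^sub>R b) - g x - h n *\<^sub>R g' x) / norm (h n)) = (\<lambda>n. norm (q n x - g' x))"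
    proof
      fix n
      have "q n x - g' x = (1 / h n) *\<^sub>R (g (x + h n *\<^sub>R b) - g x - h n *\<^sub>R g' x)"
        using h[of n] by (simp add: q_def scaleR_diff_right)
      then show "norm (g (x + h n *\<^sub>R b) - g x - h n *\<^sub>R g' x) / norm (h n) = norm (q n x - g' x)"
        by simp
    qed
    finally have "(\<lambda>n. q n x - g' x) \<longlonglongrightarrow> 0" by (rule tendsto_norm_zero_cancel)
    then show ?thesis by (simp add: LIM_zero_iff)
  qed
  have bound: "norm (q n x) \<le> B * indicator (cball 0 (R + norm b)) x" for n x
  proof (cases "x \<in> cball 0 (R + norm b)")
    case True
    have "((\<lambda>u. g (x + u *\<^sub>R b)) has_derivative (\<lambda>u. u *\<^sub>R g' (x + s *\<^sub>R b))) (at s)" for s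
    proof -
      have "((\<lambda>u. u - s) has_derivative (\<lambda>u. u)) (at s)"
        by (auto intro!: derivative_eq_intros)
      moreover have "((\<lambda>u. g ((x + s *\<^sub>R b) + u *\<^sub>R b)) has_derivative (\<lambda>u. u *\<^sub>R g' (x + s *\<^sub>R b))) (at (s - s))"
        using deriv[of "x + s *\<^sub>R b"] unfolding has_vector_derivative_def by simp
      ultimately have "((\<lambda>u. g ((x + s *\<^sub>R b) + (u - s) *\<^sub>R b)) has_derivative (\<lambda>u. u *\<^sub>R g' (x + s *\<^sub>R b))) (at s)"
        by (rule has_derivative_compose)
      then show ?thesis by (simp add: algebra_simps)
    qed
    moreover have "continuous_on {0..h n} (\<lambda>u. g (x + u *\<^sub>R b))"
      by (rule continuous_on_compose2[OF g]) (auto intro!: continuous_intros)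
    \<comment> \<open>The mean value inequality bounds the difference quotients by the maximum of \<open>g'\<close>.\<close>
    ultimately obtain s where "norm (g (x + h n *\<^sub>R b) - g (x + 0 *\<^sub>R b)) \<le> norm ((h n - 0) *\<^sub>R g' (x + s *\<^sub>R b))"
      using mvt_general[OF h(1)[of n], of "\<lambda>u. g (x + u *\<^sub>R b)" "\<lambda>s u. u *\<^sub>R g' (x + s *\<^sub>R b)"] by blast
    also have "\<dots> \<le> h n * B" using B h(1)[of n] by simp
    finally have "(1 / h n) * norm (g (x + h n *\<^sub>R b) - g x) \<le> (1 / h n) * (h n * B)"
      using h(1)[of n] by (intro mult_left_mono) auto
    moreover have "norm (q n x) = (1 / h n) * norm (g (x + h n *\<^sub>R b) - g x)"
      unfolding q_def norm_scaleR using h(1)[of n] by simp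
    ultimately have "norm (q n x) \<le> (1 / h n) * (h n * B)" by simp
    then show ?thesis using True h(1)[of n] by simp
  next
    case False
    have nb: "norm (h n *\<^sub>R b) \<le> norm b" using h[of n] by (simp add: mult_left_le_one_le)
    have "x \<notin> K" using R[of x] False by (auto, smt (verit) norm_ge_zero)
    moreover have "x + h n *\<^sub>R b \<notin> K"
      using R[of "x + h n *\<^sub>R b"] False nb norm_diff_ineq[of x "h n *\<^sub>R b"] by fastforce
    ultimately show ?thesis using False by (simp add: q_def supp)
  qed
  have "(\<lambda>n. integral\<^sup>L lborel (q n)) \<longlonglongrightarrow> integral\<^sup>L lborel g'"
  proof (rule integral_dominated_convergence[where w="\<lambda>x. B * indicator (cball 0 (R + norm b)) x"])
    show "g' \<in> borel_measurable lborel"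
      using g' by (simp add: borel_measurable_continuous_onI)
    show "q n \<in> borel_measurable lborel" for n
    proof -
      have "continuous_on UNIV (q n)"
        unfolding q_def by (intro continuous_intros g continuous_on_compose2[OF g]) auto
      then show ?thesis by (simp add: borel_measurable_continuous_onI)
    qed
    show "integrable lborel (\<lambda>x. B * indicator (cball 0 (R + norm b)) x)"
      using emeasure_bounded_finite[OF bounded_cball, of 0 "R + norm b"]
      by (intro integrable_mult_right integrable_real_indicator) auto
  qed (use lim bound in auto)
  then show ?thesis unfolding int_q using LIMSEQ_unique tendsto_const by blast
qed

lemma integral_by_parts_poly_on_lines:
  fixes f :: "'a::euclidean_space \<Rightarrow> real" and p :: "'a \<Rightarrow> 'b::euclidean_space"
  assumes f: "\<And>x. f differentiable (at x)"
    and f': "continuous_on UNIV (\<lambda>x. frechet_derivative f (at x) b)"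
    and K: "compact K" and supp: "\<And>x. x \<notin> K \<Longrightarrow> f x = 0" "\<And>x. x \<notin> K \<Longrightarrow> frechet_derivative f (at x) b = 0"
    and p: "poly_on_lines r p" "continuous_on UNIV p"
  shows "(\<integral>x. frechet_derivative f (at x) b *\<^sub>R p x \<partial>lborel) = - (\<integral>x. f x *\<^sub>R dir_deriv b p x \<partial>lborel)"
proof -
  let ?f' = "\<lambda>x. frechet_derivative f (at x) b"
  have cont: "continuous_on UNIV f"
    using f by (simp add: continuous_at_imp_continuous_on differentiable_imp_continuous_within)
  note dp = dir_deriv_poly_on_lines[OF p, where b=b]
  have deriv: "((\<lambda>s. f (x + s *\<^sub>R b) *\<^sub>R p (x + s *\<^sub>R b)) has_vector_derivative (?f' x *\<^sub>R p x + f x *\<^sub>R dir_deriv b p x)) (at 0)" for x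
  proof -
    have F: "(f has_derivative frechet_derivative f (at x)) (at x)"
      using f frechet_derivative_works by blast
    have "((\<lambda>s::real. x + s *\<^sub>R b) has_derivative (\<lambda>s. s *\<^sub>R b)) (at 0)"
      by (auto intro!: derivative_eq_intros)
    then have "((\<lambda>s. f (x + s *\<^sub>R b)) has_derivative (\<lambda>s. frechet_derivative f (at x) (s *\<^sub>R b))) (at 0)"
      by (rule has_derivative_compose) (use F in simp)
    moreover have "frechet_derivative f (at x) (s *\<^sub>R b) = s *\<^sub>R ?f' x" for s
      using F by (intro linear_scale has_derivative_linear)
    ultimately have "((\<lambda>s. f (x + s *\<^sub>R b)) has_vector_derivative ?f' x) (at 0)"
      unfolding has_vector_derivative_def by simp
    then have "((\<lambda>s. f (x + s *\<^sub>R b)) has_real_derivative ?f' x) (at 0)"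
      by (simp add: has_real_derivative_iff_has_vector_derivative)
    from has_vector_derivative_scaleR[OF this dp(3)[of x]]
    show ?thesis by (simp add: add.commute)
  qed
  have "integral\<^sup>L lborel (\<lambda>x. ?f' x *\<^sub>R p x + f x *\<^sub>R dir_deriv b p x) = 0"
    by (rule integral_dir_deriv_compact_support[OF _ _ deriv K])
       (auto intro!: continuous_intros cont f' p dp simp: supp)
  moreover have "integrable lborel (\<lambda>x. ?f' x *\<^sub>R p x)" "integrable lborel (\<lambda>x. f x *\<^sub>R dir_deriv b p x)"
    by (auto intro!: integrable_lborel_compact_support[OF _ K] continuous_intros cont f' p dp simp: supp)
  ultimately show ?thesis by (simp add: eq_neg_iff_add_eq_0)
qed

lemma pderivs_Cons: "pderivs (b # bs) f = (\<lambda>x. frechet_derivative (pderivs bs f) (at x) b)"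
  by (simp add: pderivs_def)

lemma pderivs_Nil: "pderivs [] f = f"
  by (simp add: pderivs_def)

lemma pderivs_eq_0_outside:
  assumes "closed K" "\<And>x. x \<notin> K \<Longrightarrow> f x = 0" "x \<notin> K"
  shows "pderivs bs f x = 0"
  using assms(3)
proof (induction bs arbitrary: x)
  case Nil
  then show ?case using assms by (simp add: pderivs_Nil)
next
  case (Cons b bs)
  have "((\<lambda>_. 0) has_derivative (\<lambda>_. 0)) (at x)" by simp
  then have "(pderivs bs f has_derivative (\<lambda>_. 0)) (at x)"
    by (rule has_derivative_transform_within_open[of _ _ _ _ "- K"]) (use assms Cons in auto)
  then show ?case by (simp add: pderivs_Cons frechet_derivative_at[symmetric])
qed

lemma
  assumes "smooth f" "bs \<in> lists Basis"
  shows smooth_pderivs_differentiable: "pderivs bs f differentiable (at x)"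
    and smooth_pderivs_continuous: "continuous_on UNIV (pderivs bs f)"
proof -
  show *: "pderivs bs f differentiable (at x)" for x
    using assms unfolding smooth_def by blast
  then show "continuous_on UNIV (pderivs bs f)"
    by (simp add: continuous_at_imp_continuous_on differentiable_imp_continuous_within)
qed

text \<open>
  One integration by parts per direction. The outermost derivative of the test function belongs to
  the head of the list, which is therefore the first one to reach the polynomial.
\<close>

lemma integral_pderivs_poly_on_lines:
  fixes \<phi> :: "'a::euclidean_space \<Rightarrow> real" and p :: "'a \<Rightarrow> 'b::euclidean_space"
  assumes \<phi>: "smooth \<phi>" and K: "compact K" "\<And>x. x \<notin> K \<Longrightarrow> \<phi> x = 0"
    and "bs \<in> lists Basis" "poly_on_lines r p" "continuous_on UNIV p"
  shows "(\<integral>x. pderivs bs \<phi> x *\<^sub>R p x \<partial>lborel) = (- 1) ^ length bs *\<^sub>R (\<integral>x. \<phi> x *\<^sub>R dir_derivs bs p x \<partial>lborel)"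
  using assms(4-)
proof (induction bs arbitrary: p rule: list.induct)
  case Nil
  then show ?case by (simp add: pderivs_Nil)
next
  case (Cons b bs)
  note p = Cons.prems(2,3)
  have bs: "bs \<in> lists Basis" using Cons.prems by simp
  note zero = pderivs_eq_0_outside[OF compact_imp_closed[OF K(1)] K(2)]
  have "(\<integral>x. pderivs (b # bs) \<phi> x *\<^sub>R p x \<partial>lborel) = - (\<integral>x. pderivs bs \<phi> x *\<^sub>R dir_deriv b p x \<partial>lborel)"
    unfolding pderivs_Cons
    by (rule integral_by_parts_poly_on_lines[OF smooth_pderivs_differentiable[OF \<phi> bs] _ K(1) zero _ p])
       (use smooth_pderivs_continuous[OF \<phi> Cons.prems(1)] zero[where bs = "b # bs"] in \<open>simp_all add: pderivs_Cons\<close>)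
  also have "\<dots> = - ((- 1) ^ length bs *\<^sub>R (\<integral>x. \<phi> x *\<^sub>R dir_derivs bs (dir_deriv b p) x \<partial>lborel))"
    using Cons.IH[OF bs dir_deriv_poly_on_lines(1,2)[OF p]] by simp
  finally show ?case by simp
qed

lemma locally_integrable_continuous:
  fixes p :: "'a::euclidean_space \<Rightarrow> 'b::euclidean_space"
  assumes p: "continuous_on UNIV p" and eq: "\<And>x. x \<in> U \<Longrightarrow> v x = p x"
  shows "locally_integrable U v"
  unfolding locally_integrable_def
proof (intro allI impI, elim conjE)
  fix K :: "'a set" assume K: "compact K" "K \<subseteq> U"
  have int: "integrable lborel (\<lambda>x. indicator K x *\<^sub>R p x)"
    using p K by (intro borel_integrable_compact) (auto intro: continuous_on_subset)
  have "integrable lebesgue (\<lambda>x. indicator K x *\<^sub>R p x)"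
    by (rule integrable_completion[OF borel_measurable_integrable[OF int], THEN iffD2, OF int])
  also have "(\<lambda>x. indicator K x *\<^sub>R p x) = (\<lambda>x. indicator K x *\<^sub>R v x)"
    using K eq by (auto simp: indicator_def fun_eq_iff)
  finally show "v absolutely_integrable_on K" unfolding set_integrable_def .
qed

lemma has_weak_deriv_poly_on_lines:
  fixes p :: "'a::euclidean_space \<Rightarrow> 'b::euclidean_space"
  assumes U: "open U" and p: "poly_on_lines r p" "continuous_on UNIV p"
    and eq: "\<And>x. x \<in> U \<Longrightarrow> v x = p x" and bs: "bs \<in> lists Basis"
  shows "has_weak_deriv U bs v (dir_derivs bs p)"
  unfolding has_weak_deriv_def
proof (intro conjI impI allI)
  note dp = dir_derivs_poly_on_lines[OF p]
  show "locally_integrable U v" "locally_integrable U (dir_derivs bs p)"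
    by (rule locally_integrable_continuous[OF p(2) eq], assumption)
       (rule locally_integrable_continuous[OF dp(2) refl])
  show "AE x in lebesgue_on U. dir_derivs bs p x = v x" if "bs = []"
    using that by (intro AE_I2) (simp add: eq space_restrict_space)
  fix \<phi> assume "test_function U \<phi>"
  then have \<phi>: "smooth \<phi>" and K: "compact (closure {x. \<phi> x \<noteq> 0})" "closure {x. \<phi> x \<noteq> 0} \<subseteq> U"
    unfolding test_function_def by auto
  let ?K = "closure {x. \<phi> x \<noteq> 0}"
  have supp: "\<phi> x = 0" if "x \<notin> ?K" for x
    using that closure_subset[of "{x. \<phi> x \<noteq> 0}"] by auto
  \<comment> \<open>The integrands vanish off a compact subset of \<open>U\<close>, so the integrals can be taken over the whole space.\<close>
  have to_lborel: "(\<integral>x. \<psi> x *\<^sub>R w x \<partial>lebesgue_on U) = (\<integral>x. \<psi> x *\<^sub>R q x \<partial>lborel)"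
    if "continuous_on UNIV \<psi>" "continuous_on UNIV q" "\<And>x. x \<notin> ?K \<Longrightarrow> \<psi> x = 0" "\<And>x. x \<in> U \<Longrightarrow> w x = q x"
    for \<psi> :: "'a \<Rightarrow> real" and w q :: "'a \<Rightarrow> 'b"
  proof -
    have "(\<integral>x. \<psi> x *\<^sub>R w x \<partial>lebesgue_on U) = (\<integral>x. indicator U x *\<^sub>R \<psi> x *\<^sub>R w x \<partial>lebesgue)"
      using U by (intro integral_restrict_space) auto
    also have "\<dots> = (\<integral>x. \<psi> x *\<^sub>R q x \<partial>lebesgue)"
      using that K(2) by (intro Bochner_Integration.integral_cong) (auto simp: indicator_def)
    also have "\<dots> = (\<integral>x. \<psi> x *\<^sub>R q x \<partial>lborel)"
      using that by (intro integral_completion) (auto intro!: borel_measurable_continuous_onI continuous_intros)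
    finally show ?thesis .
  qed
  have \<phi>_cont: "continuous_on UNIV \<phi>"
    using smooth_pderivs_continuous[OF \<phi>, of "[]"] by (simp add: pderivs_Nil)
  have "(\<integral>x. pderivs bs \<phi> x *\<^sub>R v x \<partial>lebesgue_on U) = (\<integral>x. pderivs bs \<phi> x *\<^sub>R p x \<partial>lborel)"
    by (rule to_lborel[OF smooth_pderivs_continuous[OF \<phi> bs] p(2) pderivs_eq_0_outside[OF closed_closure supp] eq])
  also have "\<dots> = (- 1) ^ length bs *\<^sub>R (\<integral>x. \<phi> x *\<^sub>R dir_derivs bs p x \<partial>lborel)"
    by (rule integral_pderivs_poly_on_lines[OF \<phi> K(1) supp bs p])
  also have "(\<integral>x. \<phi> x *\<^sub>R dir_derivs bs p x \<partial>lborel) = (\<integral>x. \<phi> x *\<^sub>R dir_derivs bs p x \<partial>lebesgue_on U)"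
    by (rule to_lborel[OF \<phi>_cont dp(2) supp refl, symmetric])
  finally show "(\<integral>x. pderivs bs \<phi> x *\<^sub>R v x \<partial>lebesgue_on U) =
     (- 1) ^ length bs *\<^sub>R (\<integral>x. \<phi> x *\<^sub>R dir_derivs bs p x \<partial>lebesgue_on U)" .
qed

text \<open>
  Bochner integrals of non-integrable functions are zero by convention, so the additivity of weak
  derivatives needs this integrability.
\<close>

lemma integrable_times_locally_integrable:
  fixes f :: "'a::euclidean_space \<Rightarrow> 'b::euclidean_space"
  assumes U: "open U" and f: "locally_integrable U f"
    and \<psi>: "continuous_on UNIV \<psi>" and K: "compact K" "K \<subseteq> U" and supp: "\<And>x. x \<notin> K \<Longrightarrow> \<psi> x = 0"
  shows "integrable (lebesgue_on U) (\<lambda>x. \<psi> x *\<^sub>R f x)"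
proof -
  have "(\<lambda>x. \<psi> x *\<^sub>R f x) absolutely_integrable_on K"
  proof (rule absolutely_integrable_bounded_measurable_product[OF iffD2[OF bilinear_conv_bounded_bilinear bounded_bilinear_scaleR]])
    show "bounded (\<psi> ` K)"
      using K(1) \<psi> by (intro compact_imp_bounded compact_continuous_image) (auto intro: continuous_on_subset)
    show "\<psi> \<in> borel_measurable (lebesgue_on K)"
      using \<psi> by (intro continuous_imp_measurable_on_sets_lebesgue fmeasurableD[OF lmeasurable_compact[OF K(1)]])
        (auto intro: continuous_on_subset)
    show "f absolutely_integrable_on K" using f K unfolding locally_integrable_def by blast
  qed (rule fmeasurableD[OF lmeasurable_compact[OF K(1)]])
  moreover have "(\<lambda>x. indicator K x *\<^sub>R \<psi> x *\<^sub>R f x) = (\<lambda>x. indicator U x *\<^sub>R \<psi> x *\<^sub>R f x)"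
    using K(2) supp by (auto simp: indicator_def fun_eq_iff)
  ultimately show ?thesis
    using U by (subst integrable_restrict_space) (auto simp: set_integrable_def)
qed

lemma has_weak_deriv_add:
  fixes f1 f2 g1 g2 :: "'a::euclidean_space \<Rightarrow> 'b::euclidean_space"
  assumes U: "open U" and bs: "bs \<in> lists Basis"
    and 1: "has_weak_deriv U bs f1 g1" and 2: "has_weak_deriv U bs f2 g2"
  shows "has_weak_deriv U bs (\<lambda>x. f1 x + f2 x) (\<lambda>x. g1 x + g2 x)"
  unfolding has_weak_deriv_def
proof (intro conjI impI allI)
  note li = 1[unfolded has_weak_deriv_def, THEN conjunct1] 1[unfolded has_weak_deriv_def, THEN conjunct2, THEN conjunct1]
    2[unfolded has_weak_deriv_def, THEN conjunct1] 2[unfolded has_weak_deriv_def, THEN conjunct2, THEN conjunct1]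
  show "locally_integrable U (\<lambda>x. f1 x + f2 x)" "locally_integrable U (\<lambda>x. g1 x + g2 x)"
    using li unfolding locally_integrable_def by (auto intro: set_integral_add)
  show "AE x in lebesgue_on U. g1 x + g2 x = f1 x + f2 x" if "bs = []"
  proof -
    have "AE x in lebesgue_on U. g1 x = f1 x" "AE x in lebesgue_on U. g2 x = f2 x"
      using 1 2 that unfolding has_weak_deriv_def by auto
    then show ?thesis by eventually_elim simp
  qed
  fix \<phi> assume t: "test_function U \<phi>"
  then have \<phi>: "smooth \<phi>" and K: "compact (closure {x. \<phi> x \<noteq> 0})" "closure {x. \<phi> x \<noteq> 0} \<subseteq> U"
    unfolding test_function_def by auto
  have supp: "\<phi> x = 0" if "x \<notin> closure {x. \<phi> x \<noteq> 0}" for x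
    using that closure_subset[of "{x. \<phi> x \<noteq> 0}"] by auto
  have int: "integrable (lebesgue_on U) (\<lambda>x. pderivs bs' \<phi> x *\<^sub>R f x)"
    if "locally_integrable U f" "bs' \<in> lists Basis" for f :: "'a \<Rightarrow> 'b" and bs'
    by (rule integrable_times_locally_integrable[OF U that(1) smooth_pderivs_continuous[OF \<phi> that(2)] K])
       (rule pderivs_eq_0_outside[OF closed_closure supp])
  show "(\<integral>x. pderivs bs \<phi> x *\<^sub>R (f1 x + f2 x) \<partial>lebesgue_on U) =
        (- 1) ^ length bs *\<^sub>R (\<integral>x. \<phi> x *\<^sub>R (g1 x + g2 x) \<partial>lebesgue_on U)"
    using 1 2 t int[OF li(1) bs] int[OF li(3) bs] int[OF li(2), of "[]"] int[OF li(4), of "[]"]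
    unfolding has_weak_deriv_def by (simp add: scaleR_add_right pderivs_Nil)
qed

lemma locally_integrable_measurable:
  fixes f :: "'a::euclidean_space \<Rightarrow> 'b::euclidean_space"
  assumes U: "open U" and f: "locally_integrable U f"
  shows "f \<in> borel_measurable (lebesgue_on U)"
proof -
  obtain D where D: "\<And>X. X \<in> D \<Longrightarrow> \<exists>a b. X = cbox a b" "\<Union>D = U" "countable D" "\<And>X. X \<in> D \<Longrightarrow> X \<subseteq> U"
    using open_countable_Union_open_cbox[OF U] by (metis Union_upper)
  show ?thesis
  proof (rule measurable_piecewise_restrict[OF D(3)])
    show "space (lebesgue_on U) \<subseteq> \<Union>D" using D(2) by (simp add: space_restrict_space)
    fix X assume X: "X \<in> D"
    then have "compact X" "X \<subseteq> U" using D(1,4) compact_cbox by fastforce+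
    then have "f absolutely_integrable_on X" using f unfolding locally_integrable_def by blast
    moreover have Xm: "X \<in> sets lebesgue"
      using lmeasurable_compact[OF \<open>compact X\<close>] by (rule fmeasurableD)
    ultimately have "f \<in> borel_measurable (lebesgue_on X)"
      using absolutely_integrable_measurable by blast
    moreover have "restrict_space (lebesgue_on U) X = lebesgue_on X"
      using \<open>X \<subseteq> U\<close> by (simp add: restrict_restrict_space U Xm inf.absorb2)
    ultimately show "f \<in> borel_measurable (restrict_space (lebesgue_on U) X)" by simp
    show "X \<inter> space (lebesgue_on U) \<in> sets (lebesgue_on U)"
      using \<open>X \<subseteq> U\<close> U Xm by (simp add: sets_restrict_space_iff space_restrict_space inf.absorb1)
  qed
qed

section \<open>Geometry of mesh elements\<close>

text \<open>
  If \<open>y\<close> is in the closure of \<open>S\<close>, then every point of the segment from \<open>c\<close> to \<open>y\<close> other than \<open>y\<close> is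
  interior: it lies in the cone spanned by the ball and a point of \<open>S\<close> close to \<open>y\<close>. So every ray
  from \<open>c\<close> meets the frontier at most once, and such closed sets are null sets.
\<close>

lemma negligible_frontier_star_shaped:
  fixes S :: "'a::euclidean_space set"
  assumes star: "star_shaped_wrt S (ball c \<rho>)" and \<rho>: "0 < \<rho>"
  shows "negligible (frontier S)"
proof (rule starlike_negligible_strong[OF frontier_closed, of c])
  fix k :: real and x
  assume k: "0 \<le> k" "k < 1" and x: "c + x \<in> frontier S"
  have pos: "0 < (1 - k) * \<rho>" using k \<rho> by simp
  obtain z where z: "z \<in> S" "dist z (c + x) < (1 - k) * \<rho>"
    using x pos closure_approachable[of "c + x" S] by (auto simp: frontier_def)
  have hull: "convex hull ({z} \<union> ball c \<rho>) \<subseteq> S"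
    using star z(1) unfolding star_shaped_wrt_def by blast
  have "ball (k *\<^sub>R z + (1 - k) *\<^sub>R c) ((1 - k) * \<rho>) \<subseteq> S"
  proof
    fix y assume "y \<in> ball (k *\<^sub>R z + (1 - k) *\<^sub>R c) ((1 - k) * \<rho>)"
    then have y: "norm (k *\<^sub>R z + (1 - k) *\<^sub>R c - y) < (1 - k) * \<rho>" by (simp add: dist_norm)
    define w where "w = (1 / (1 - k)) *\<^sub>R (y - k *\<^sub>R z)"
    have yw: "y = k *\<^sub>R z + (1 - k) *\<^sub>R w" using k by (simp add: w_def)
    have "k *\<^sub>R z + (1 - k) *\<^sub>R c - y = (1 - k) *\<^sub>R (c - w)"
      unfolding yw by (simp add: algebra_simps)
    then have "(1 - k) * norm (c - w) < (1 - k) * \<rho>" using y k by simp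
    then have "w \<in> ball c \<rho>" using k by (simp add: dist_norm)
    then have "w \<in> convex hull ({z} \<union> ball c \<rho>)" "z \<in> convex hull ({z} \<union> ball c \<rho>)"
      by (auto intro: hull_inc)
    then have "y \<in> convex hull ({z} \<union> ball c \<rho>)"
      unfolding yw using k by (intro convexD[OF convex_convex_hull]) auto
    then show "y \<in> S" using hull by blast
  qed
  moreover have "c + k *\<^sub>R x \<in> ball (k *\<^sub>R z + (1 - k) *\<^sub>R c) ((1 - k) * \<rho>)"
  proof -
    have "k *\<^sub>R z + (1 - k) *\<^sub>R c - (c + k *\<^sub>R x) = k *\<^sub>R (z - (c + x))"
      by (simp add: algebra_simps)
    then have "dist (k *\<^sub>R z + (1 - k) *\<^sub>R c) (c + k *\<^sub>R x) = k * dist z (c + x)"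
      using k by (simp add: dist_norm)
    also have "\<dots> \<le> dist z (c + x)" using k by (simp add: mult_left_le_one_le)
    finally show ?thesis using z(2) by simp
  qed
  ultimately have "c + k *\<^sub>R x \<in> interior S"
    using open_ball interior_maximal by blast
  then show "c + k *\<^sub>R x \<notin> frontier S" by (simp add: frontier_def)
qed

lemma outer_diam_properties:
  fixes e :: "'a::euclidean_space set"
  assumes "bounded e" "interior e \<noteq> {}"
  shows "0 < outer_diam e"
    and "c \<in> e \<Longrightarrow> e \<subseteq> ball c (2 * outer_diam e)"
    and "0 \<le> inner_diam e"
proof -
  let ?D = "{2 * R | R. \<exists>c. e \<subseteq> cball c R}"
  obtain x \<epsilon> where \<epsilon>: "0 < \<epsilon>" "ball x \<epsilon> \<subseteq> e"
    using assms(2) mem_interior by blast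
  \<comment> \<open>A ball inside \<open>e\<close> has radius at most that of any enclosing ball.\<close>
  have low: "\<epsilon> \<le> R" if "e \<subseteq> cball a R" for a R
  proof -
    have "ball x \<epsilon> \<subseteq> cball a R" using \<epsilon>(2) that by blast
    then have "dist x a + \<epsilon> \<le> R \<or> \<epsilon> \<le> 0" by (simp add: ball_subset_cball_iff)
    then show ?thesis using \<epsilon>(1) zero_le_dist[of x a] by linarith
  qed
  obtain a R where aR: "e \<subseteq> cball a R" 
    using assms(1) bounded_subset_cball by metis
  then have ne: "?D \<noteq> {}" by blast
  have "2 * \<epsilon> \<le> outer_diam e"
    unfolding outer_diam_def using low by (intro cInf_greatest[OF ne]) fastforce
  with \<epsilon> show pos: "0 < outer_diam e" by simp
  \<comment> \<open>The outer diameter is an infimum; an enclosing ball of less than twice the minimal radius suffices.\<close>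
  have "\<exists>y\<in>?D. y < 2 * outer_diam e"
    using cInf_lessD[OF ne, of "2 * outer_diam e"] pos unfolding outer_diam_def by auto
  then obtain a' R' where R': "e \<subseteq> cball a' R'" "R' < outer_diam e" by auto
  show "e \<subseteq> ball c (2 * outer_diam e)" if "c \<in> e"
  proof
    fix y assume "y \<in> e"
    then have "dist a' y \<le> R'" "dist a' c \<le> R'" using R' that by auto
    then show "y \<in> ball c (2 * outer_diam e)"
      using R'(2) dist_triangle3[of c y a'] by simp
  qed
  let ?I = "{2 * R | R. 0 \<le> R \<and> (\<exists>c. ball c R \<subseteq> e)}"
  have "bdd_above ?I"
  proof (rule bdd_aboveI[of _ "2 * max R 0"])
    fix y assume "y \<in> ?I"
    then obtain b r where br: "y = 2 * r" "0 \<le> r" "ball b r \<subseteq> e" by auto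
    then have "ball b r \<subseteq> cball a R" using aR by blast
    then have "dist b a + r \<le> R \<or> r \<le> 0" by (simp add: ball_subset_cball_iff)
    then show "y \<le> 2 * max R 0" using br zero_le_dist[of b a] by linarith
  qed
  moreover have "0 \<in> ?I" by (auto intro!: exI[of _ 0])
  ultimately show "0 \<le> inner_diam e" unfolding inner_diam_def by (rule cSup_upper[rotated])
qed

text \<open>
  What the estimates need from nondegeneracy. The inscribed and the enclosing ball have the same
  centre because the estimates on balls compare concentric balls.
\<close>

definition regular_element :: "real \<Rightarrow> 'a::euclidean_space set \<Rightarrow> bool" where
  "regular_element \<gamma> e \<longleftrightarrow> 0 < \<gamma> \<and> 0 < outer_diam e \<and> negligible (frontier e) \<and>
     (\<exists>c. ball c (outer_diam e / \<gamma>) \<subseteq> interior e \<and> e \<subseteq> ball c (2 * outer_diam e))"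

text \<open>
  A nonempty star-shaped piece contains its ball, which serves as the inscribed ball and whose centre
  serves for both balls. The frontier of \<open>e\<close> is covered by the null frontiers of finitely many pieces.
  That \<open>\<gamma>\<close> is positive follows from the bound on the outer diameter.
\<close>

lemma nondegenerate_imp_regular_element:
  assumes nd: "nondegenerate \<gamma> D H M" and "h \<in> H" "e \<in> M h" and mesh: "is_mesh \<Omega> (M h)"
  shows "regular_element \<gamma> e"
proof -
  have e: "bounded e" "interior e \<noteq> {}"
    using mesh \<open>e \<in> M h\<close> unfolding is_mesh_def by auto
  note d = outer_diam_properties[OF e]
  have "outer_diam e \<le> \<gamma> * inner_diam e \<and>
    (\<exists>\<S>. finite \<S> \<and> card \<S> \<le> D \<and> \<Union>\<S> = e \<and>
             (\<forall>S\<in>\<S>. S \<noteq> {} \<and> (\<exists>c. star_shaped_wrt S (ball c (outer_diam e / \<gamma>)))))"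
    using nd assms(2,3) unfolding nondegenerate_def by blast
  then obtain \<S> where le: "outer_diam e \<le> \<gamma> * inner_diam e" and S: "finite \<S>" "\<Union>\<S> = e"
    and star: "\<And>S. S \<in> \<S> \<Longrightarrow> S \<noteq> {} \<and> (\<exists>c. star_shaped_wrt S (ball c (outer_diam e / \<gamma>)))"
    by auto
  have \<gamma>: "0 < \<gamma>"
  proof (rule ccontr)
    assume "\<not> 0 < \<gamma>"
    then have "\<gamma> * inner_diam e \<le> 0" using d(3) by (simp add: mult_nonpos_nonneg)
    then show False using le d(1) by simp
  qed
  then have \<rho>: "0 < outer_diam e / \<gamma>" using d(1) by simp
  have "frontier e \<subseteq> (\<Union>S\<in>\<S>. frontier S)"
    using frontier_Union_subset[OF S(1)] S(2) by simp
  moreover have "negligible (\<Union>S\<in>\<S>. frontier S)"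
    using S(1) star \<rho> negligible_frontier_star_shaped by (intro negligible_Union) blast+
  ultimately have "negligible (frontier e)" using negligible_subset by blast
  moreover obtain S c where Sc: "S \<in> \<S>" "S \<noteq> {}" "star_shaped_wrt S (ball c (outer_diam e / \<gamma>))"
    using S(2) star e(2) interior_subset[of e] by blast
  then obtain z where "z \<in> S" by blast
  then have "convex hull ({z} \<union> ball c (outer_diam e / \<gamma>)) \<subseteq> S"
    using Sc(3) unfolding star_shaped_wrt_def by blast
  then have "ball c (outer_diam e / \<gamma>) \<subseteq> e"
    using Sc(1) S(2) hull_subset[of "{z} \<union> ball c (outer_diam e / \<gamma>)" convex] by blast
  moreover from this have "c \<in> e" using \<rho> centre_in_ball by blast
  ultimately show ?thesis
    unfolding regular_element_def using \<gamma> d(1) d(2)[of c] interior_maximal open_ball by blast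
qed

section \<open>Broken Sobolev norms on one element\<close>

lemma nn_integral_lebesgue_on_interior:
  assumes "negligible (frontier e)"
  shows "(\<integral>\<^sup>+x. f x \<partial>lebesgue_on e) = (\<integral>\<^sup>+x. f x \<partial>lebesgue_on (interior e))"
proof -
  have int: "interior e \<in> sets lebesgue" by simp
  have sub: "e - interior e \<subseteq> frontier e" using closure_subset by (auto simp: frontier_def)
  have "e = interior e \<union> (e - interior e)" using interior_subset by blast
  moreover have "e - interior e \<in> sets lebesgue"
    using negligible_subset[OF assms sub] negligible_imp_sets by blast
  ultimately have e: "e \<in> sets lebesgue" using int sets.Un by metis
  have "AE x in lebesgue. x \<notin> frontier e"
    using assms by (intro AE_not_in) (simp add: negligible_iff_null_sets)
  then have "AE x in lebesgue. f x * indicator e x = f x * indicator (interior e) x"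
    by eventually_elim (use sub interior_subset[of e] in \<open>auto simp: indicator_def\<close>)
  then show ?thesis
    using e int by (simp add: nn_integral_restrict_space nn_integral_cong_AE)
qed

text \<open>
  Any admissible weak derivative of order zero is almost everywhere equal to \<open>f\<close>.
\<close>

lemma L2_norm_sq_interior_le_grad_norm_sq_0:
  fixes f :: "'a::euclidean_space \<Rightarrow> 'b::euclidean_space"
  assumes "negligible (frontier e)"
  shows "L2_norm_sq (interior e) f \<le> grad_norm_sq 0 e f"
  unfolding grad_norm_sq_def
proof (rule INF_greatest)
  fix G assume G: "G \<in> {G. \<forall>bs\<in>dir_lists 0. has_weak_deriv (interior e) bs f (G bs)}"
  have d0: "dir_lists 0 = {[] :: 'a list}" by (auto simp: dir_lists_def)
  have "AE x in lebesgue_on (interior e). G [] x = f x"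
    using G unfolding d0 has_weak_deriv_def by auto
  then have "AE x in lebesgue_on (interior e). ennreal ((norm (f x))\<^sup>2) = ennreal ((norm (G [] x))\<^sup>2)"
    by eventually_elim simp
  then have "L2_norm_sq (interior e) f = (\<integral>\<^sup>+x. ennreal ((norm (G [] x))\<^sup>2) \<partial>lebesgue_on (interior e))"
    unfolding L2_norm_sq_def by (rule nn_integral_cong_AE)
  then show "L2_norm_sq (interior e) f \<le> (\<integral>\<^sup>+x. ennreal (\<Sum>bs\<in>dir_lists 0. (norm (G bs x))\<^sup>2) \<partial>lebesgue_on e)"
    unfolding nn_integral_lebesgue_on_interior[OF assms] by (simp add: d0)
qed

lemma norm_add_squared_le: "(norm (x + y))\<^sup>2 \<le> 2 * (norm x)\<^sup>2 + 2 * (norm (y::'b::real_normed_vector))\<^sup>2"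
proof -
  have "(norm (x + y))\<^sup>2 \<le> (norm x + norm y)\<^sup>2" by (intro power_mono norm_triangle_ineq) auto
  also have "\<dots> \<le> 2 * (norm x)\<^sup>2 + 2 * (norm y)\<^sup>2"
    using sum_squares_bound[of "norm x" "norm y"] by (simp add: power2_sum)
  finally show ?thesis .
qed

text \<open>
  Adding the polynomial derivatives to weak derivatives \<open>G\<close> of \<open>f\<close> gives weak derivatives of the
  sum. As \<^const>\<open>grad_norm_sq\<close> is an infimum, \<open>G\<close> is chosen optimal up to \<open>\<epsilon>\<close>; if \<open>f\<close> has no weak
  derivatives, the right-hand side is infinite.
\<close>

lemma grad_norm_sq_add_poly:
  fixes f v p :: "'a::euclidean_space \<Rightarrow> 'b::euclidean_space"
  assumes e: "negligible (frontier e)"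
    and p: "poly_on_lines r p" "continuous_on UNIV p" and v: "\<And>x. x \<in> interior e \<Longrightarrow> v x = p x"
  shows "grad_norm_sq m e (\<lambda>x. f x + v x)
    \<le> 2 * grad_norm_sq m e f + 2 * (\<Sum>bs\<in>dir_lists m. L2_norm_sq (interior e) (dir_derivs bs p))"
proof (rule ennreal_le_epsilon)
  fix \<epsilon> :: real assume "0 < \<epsilon>" and fin: "2 * grad_norm_sq m e f + 2 * (\<Sum>bs\<in>dir_lists m. L2_norm_sq (interior e) (dir_derivs bs p)) < top"
  let ?U = "interior e" and ?A = "dir_lists m :: 'a list set"
  let ?c = "\<Sum>bs\<in>?A. L2_norm_sq ?U (dir_derivs bs p)"
  let ?I = "\<lambda>G. \<integral>\<^sup>+x. ennreal (\<Sum>bs\<in>?A. (norm (G bs x :: 'b))\<^sup>2) \<partial>lebesgue_on ?U"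
  have dl: "bs \<in> lists Basis" if "bs \<in> ?A" for bs using that by (auto simp: dir_lists_def)
  have grad: "grad_norm_sq m e g = (INF G \<in> {G. \<forall>bs\<in>?A. has_weak_deriv ?U bs g (G bs)}. ?I G)" for g
    unfolding grad_norm_sq_def nn_integral_lebesgue_on_interior[OF e] ..
  have "grad_norm_sq m e f < top"
    using fin by (auto simp: ennreal_mult_less_top)
  then have "grad_norm_sq m e f < grad_norm_sq m e f + ennreal (\<epsilon> / 2)"
    using \<open>0 < \<epsilon>\<close> by (simp add: ennreal_add_left_cancel_less less_top)
  then obtain G where G: "\<And>bs. bs \<in> ?A \<Longrightarrow> has_weak_deriv ?U bs f (G bs)"
    and lt: "?I G < grad_norm_sq m e f + ennreal (\<epsilon> / 2)"
    unfolding grad INF_less_iff by blast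
  have G_meas: "G bs \<in> borel_measurable (lebesgue_on ?U)" if "bs \<in> ?A" for bs
    using G[OF that] unfolding has_weak_deriv_def by (intro locally_integrable_measurable) auto
  have D_meas: "dir_derivs bs p \<in> borel_measurable (lebesgue_on ?U)" for bs
    by (rule continuous_imp_measurable_on_sets_lebesgue)
       (auto intro: continuous_on_subset[OF dir_derivs_poly_on_lines(2)[OF p]])
  define H where "H bs x = G bs x + dir_derivs bs p x" for bs x
  have "has_weak_deriv ?U bs (\<lambda>x. f x + v x) (H bs)" if "bs \<in> ?A" for bs
    unfolding H_def
    by (intro has_weak_deriv_add G has_weak_deriv_poly_on_lines[OF _ p v] dl that open_interior)
  then have "grad_norm_sq m e (\<lambda>x. f x + v x) \<le> ?I H"
    unfolding grad by (intro INF_lower) auto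
  also have "?I H \<le> (\<integral>\<^sup>+x. (2 * ennreal (\<Sum>bs\<in>?A. (norm (G bs x))\<^sup>2)
      + 2 * (\<Sum>bs\<in>?A. ennreal ((norm (dir_derivs bs p x))\<^sup>2))) \<partial>lebesgue_on ?U)"
  proof (rule nn_integral_mono)
    fix x
    have "(\<Sum>bs\<in>?A. (norm (H bs x))\<^sup>2) \<le> (\<Sum>bs\<in>?A. 2 * (norm (G bs x))\<^sup>2 + 2 * (norm (dir_derivs bs p x))\<^sup>2)"
      unfolding H_def by (intro sum_mono norm_add_squared_le)
    also have "\<dots> = 2 * (\<Sum>bs\<in>?A. (norm (G bs x))\<^sup>2) + 2 * (\<Sum>bs\<in>?A. (norm (dir_derivs bs p x))\<^sup>2)"
      by (simp add: sum.distrib sum_distrib_left)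
    finally have "ennreal (\<Sum>bs\<in>?A. (norm (H bs x))\<^sup>2)
      \<le> ennreal (2 * (\<Sum>bs\<in>?A. (norm (G bs x))\<^sup>2) + 2 * (\<Sum>bs\<in>?A. (norm (dir_derivs bs p x))\<^sup>2))"
      by (rule ennreal_leI)
    also have "\<dots> = 2 * ennreal (\<Sum>bs\<in>?A. (norm (G bs x))\<^sup>2) + 2 * (\<Sum>bs\<in>?A. ennreal ((norm (dir_derivs bs p x))\<^sup>2))"
      by (simp add: ennreal_mult' sum_nonneg sum_ennreal)
    finally show "ennreal (\<Sum>bs\<in>?A. (norm (H bs x))\<^sup>2) \<le> 2 * ennreal (\<Sum>bs\<in>?A. (norm (G bs x))\<^sup>2)
      + 2 * (\<Sum>bs\<in>?A. ennreal ((norm (dir_derivs bs p x))\<^sup>2))" .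
  qed
  also have "\<dots> = 2 * ?I G + 2 * ?c"
  proof -
    have m1: "(\<lambda>x. ennreal (\<Sum>bs\<in>?A. (norm (G bs x))\<^sup>2)) \<in> borel_measurable (lebesgue_on ?U)"
      using G_meas by (intro measurable_compose[OF _ measurable_ennreal] borel_measurable_sum) measurable
    have m2: "(\<lambda>x. ennreal ((norm (dir_derivs bs p x))\<^sup>2)) \<in> borel_measurable (lebesgue_on ?U)" for bs
      using D_meas by measurable
    have m3: "(\<lambda>x. \<Sum>bs\<in>?A. ennreal ((norm (dir_derivs bs p x))\<^sup>2)) \<in> borel_measurable (lebesgue_on ?U)"
      by (intro borel_measurable_sum m2)
    show ?thesis
      unfolding L2_norm_sq_def nn_integral_sum[OF m2, symmetric] nn_integral_cmult[OF m1, symmetric]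
        nn_integral_cmult[OF m3, symmetric]
      by (rule nn_integral_add) (rule borel_measurable_times_ennreal[OF borel_measurable_const m1]
            borel_measurable_times_ennreal[OF borel_measurable_const m3])+
  qed
  also have "\<dots> \<le> 2 * (grad_norm_sq m e f + ennreal (\<epsilon> / 2)) + 2 * ?c"
    using lt by (intro add_right_mono mult_left_mono) auto
  also have "\<dots> = 2 * grad_norm_sq m e f + 2 * ?c + ennreal \<epsilon>"
  proof -
    have "2 * ennreal (\<epsilon> / 2) = ennreal \<epsilon>"
      using \<open>0 < \<epsilon>\<close> by (subst ennreal_numeral[symmetric], subst ennreal_mult[symmetric]) auto
    then show ?thesis by (simp add: distrib_left add_ac)
  qed
  finally show "grad_norm_sq m e (\<lambda>x. f x + v x) \<le> 2 * grad_norm_sq m e f + 2 * ?c + ennreal \<epsilon>" .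
qed

text \<open>
  The triangle inequality and the inverse estimate on an element, with a constant that is the same
  for all elements. For \<open>\<gamma> \<le> 0\<close> there are no regular elements.
\<close>

lemma element_inverse_estimate:
  "\<exists>K\<ge>0. \<forall>(e :: 'a::euclidean_space set) (f :: 'a \<Rightarrow> 'b::euclidean_space) v p.
     regular_element \<gamma> e \<longrightarrow> poly_deg_le r p \<longrightarrow> (\<forall>x\<in>interior e. v x = p x) \<longrightarrow>
     ennreal (outer_diam e ^ (2 * m)) * grad_norm_sq m e (\<lambda>x. f x + v x)
       \<le> 2 * (ennreal (outer_diam e ^ (2 * m)) * grad_norm_sq m e f) + ennreal K * L2_norm_sq (interior e) v"
proof (cases "0 < \<gamma>")
  case False
  then show ?thesis by (intro exI[of _ 0]) (auto simp: regular_element_def)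
next
  case True
  obtain K where K: "K \<ge> 0" and inv: "\<And>(p :: 'a \<Rightarrow> 'b) bs c d.
    \<lbrakk>poly_on_lines r p; continuous_on UNIV p; set bs \<subseteq> Basis; length bs = m; 0 < d\<rbrakk> \<Longrightarrow>
    ennreal (d ^ (2 * m)) * L2_norm_sq (ball c (2 * d)) (dir_derivs bs p) \<le> ennreal K * L2_norm_sq (ball c (d / \<gamma>)) p"
    using inverse_estimate_balls[OF True, of r m, where 'a='a and 'b='b] by blast
  define N where "N = card (dir_lists m :: 'a list set)"
  show ?thesis
  proof (intro exI[of _ "2 * (real N * K)"] conjI allI impI)
    show "0 \<le> 2 * (real N * K)" using K by simp
    fix e :: "'a set" and f v p :: "'a \<Rightarrow> 'b"
    assume reg: "regular_element \<gamma> e" and pd: "poly_deg_le r p" and v: "\<forall>x\<in>interior e. v x = p x"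
    let ?d = "outer_diam e" and ?A = "dir_lists m :: 'a list set"
    note p = poly_deg_le_imp_poly_on_lines[OF pd] poly_deg_le_imp_continuous[OF pd]
    obtain c where d: "0 < ?d" and neg: "negligible (frontier e)"
      and c: "ball c (?d / \<gamma>) \<subseteq> interior e" "e \<subseteq> ball c (2 * ?d)"
      using reg unfolding regular_element_def by blast
    have "ennreal (?d ^ (2 * m)) * L2_norm_sq (interior e) (dir_derivs bs p)
        \<le> ennreal K * L2_norm_sq (interior e) p" if "bs \<in> ?A" for bs
    proof -
      have "ennreal (?d ^ (2 * m)) * L2_norm_sq (interior e) (dir_derivs bs p)
         \<le> ennreal (?d ^ (2 * m)) * L2_norm_sq (ball c (2 * ?d)) (dir_derivs bs p)"
        using order_trans[OF interior_subset c(2)] by (intro mult_left_mono L2_norm_sq_mono_set) auto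
      also have "\<dots> \<le> ennreal K * L2_norm_sq (ball c (?d / \<gamma>)) p"
        using that d by (intro inv p) (auto simp: dir_lists_def)
      also have "\<dots> \<le> ennreal K * L2_norm_sq (interior e) p"
        using c(1) by (intro mult_left_mono L2_norm_sq_mono_set) auto
      finally show ?thesis .
    qed
    then have "(\<Sum>bs\<in>?A. ennreal (?d ^ (2 * m)) * L2_norm_sq (interior e) (dir_derivs bs p))
        \<le> (\<Sum>bs\<in>?A. ennreal K * L2_norm_sq (interior e) p)"
      by (intro sum_mono)
    also have "\<dots> = ennreal (real N * K) * L2_norm_sq (interior e) p"
      using K by (simp add: N_def ennreal_mult ennreal_of_nat_eq_real_of_nat mult.assoc)
    also have "L2_norm_sq (interior e) p = L2_norm_sq (interior e) v"
      unfolding L2_norm_sq_def using v by (intro nn_integral_cong) (simp add: space_restrict_space)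
    finally have D: "(\<Sum>bs\<in>?A. ennreal (?d ^ (2 * m)) * L2_norm_sq (interior e) (dir_derivs bs p))
       \<le> ennreal (real N * K) * L2_norm_sq (interior e) v" .
    have "ennreal (?d ^ (2 * m)) * grad_norm_sq m e (\<lambda>x. f x + v x)
      \<le> ennreal (?d ^ (2 * m)) * (2 * grad_norm_sq m e f + 2 * (\<Sum>bs\<in>?A. L2_norm_sq (interior e) (dir_derivs bs p)))"
      using v by (intro mult_left_mono grad_norm_sq_add_poly[OF neg p]) auto
    also have "\<dots> = 2 * (ennreal (?d ^ (2 * m)) * grad_norm_sq m e f)
       + 2 * (\<Sum>bs\<in>?A. ennreal (?d ^ (2 * m)) * L2_norm_sq (interior e) (dir_derivs bs p))"
      by (simp add: distrib_left sum_distrib_left mult_ac)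
    also have "\<dots> \<le> 2 * (ennreal (?d ^ (2 * m)) * grad_norm_sq m e f)
       + 2 * (ennreal (real N * K) * L2_norm_sq (interior e) v)"
      by (intro add_left_mono mult_left_mono D) auto
    also have "2 * (ennreal (real N * K) * L2_norm_sq (interior e) v) = ennreal (2 * (real N * K)) * L2_norm_sq (interior e) v"
      using K by (simp add: ennreal_mult' mult.assoc)
    finally show "ennreal (?d ^ (2 * m)) * grad_norm_sq m e (\<lambda>x. f x + v x)
       \<le> 2 * (ennreal (?d ^ (2 * m)) * grad_norm_sq m e f) + ennreal (2 * (real N * K)) * L2_norm_sq (interior e) v" .
  qed
qed

section \<open>Decomposition over a mesh\<close>

lemma mesh_cover:
  assumes mesh: "is_mesh \<Omega> M" and neg: "\<And>e. e \<in> M \<Longrightarrow> negligible (frontier e)"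
  shows "negligible (\<Omega> - (\<Union>e\<in>M. interior e))"
proof (rule negligible_subset)
  show "negligible (\<Union>e\<in>M. frontier e)"
    using mesh neg unfolding is_mesh_def by (intro negligible_Union) auto
  have "\<Omega> \<subseteq> (\<Union>e\<in>M. closure e)"
    using mesh closure_subset unfolding is_mesh_def by metis
  then show "\<Omega> - (\<Union>e\<in>M. interior e) \<subseteq> (\<Union>e\<in>M. frontier e)"
    unfolding frontier_def by blast
qed

lemma L2_norm_sq_mesh:
  fixes f :: "'a::euclidean_space \<Rightarrow> 'b::euclidean_space"
  assumes \<Omega>: "open \<Omega>" and mesh: "is_mesh \<Omega> M" and neg: "\<And>e. e \<in> M \<Longrightarrow> negligible (frontier e)"
    and f: "f \<in> borel_measurable (lebesgue_on \<Omega>)"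
  shows "L2_norm_sq \<Omega> f = (\<Sum>e\<in>M. L2_norm_sq (interior e) f)"
proof -
  have fin: "finite M" and sub: "\<And>e. e \<in> M \<Longrightarrow> interior e \<subseteq> \<Omega>"
    and disj: "\<And>e e'. e \<in> M \<Longrightarrow> e' \<in> M \<Longrightarrow> e \<noteq> e' \<Longrightarrow> interior e \<inter> interior e' = {}"
    using mesh unfolding is_mesh_def by auto
  have \<Omega>m: "\<Omega> \<inter> space lebesgue \<in> sets lebesgue" using \<Omega> by simp
  let ?F = "\<lambda>x. ennreal ((norm (f x))\<^sup>2)"
  have Fm: "?F \<in> borel_measurable (lebesgue_on \<Omega>)" using f by measurable
  have im: "(indicator (interior e) :: 'a \<Rightarrow> ennreal) \<in> borel_measurable (lebesgue_on \<Omega>)" for e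
    by (intro measurable_restrict_space1 borel_measurable_indicator) simp
  have part: "(\<integral>\<^sup>+x. ?F x * indicator (interior e) x \<partial>lebesgue_on \<Omega>) = L2_norm_sq (interior e) f" if "e \<in> M" for e
    unfolding nn_integral_restrict_space[OF \<Omega>m]
    using sub[OF that] by (subst L2_norm_sq_alt) (auto intro!: nn_integral_cong simp: indicator_def)
  have "AE x in lebesgue. x \<notin> \<Omega> - (\<Union>e\<in>M. interior e)"
    using mesh_cover[OF mesh neg] by (intro AE_not_in) (simp add: negligible_iff_null_sets)
  then have "AE x in lebesgue_on \<Omega>. ?F x = (\<Sum>e\<in>M. ?F x * indicator (interior e) x)"
    unfolding AE_restrict_space_iff[OF \<Omega>m]
  proof eventually_elim
    case (elim x)
    show ?case
    proof
      assume "x \<in> \<Omega>"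
      then obtain e where e: "e \<in> M" "x \<in> interior e" using elim by blast
      have "(\<Sum>e'\<in>M. ?F x * indicator (interior e') x) = (\<Sum>e'\<in>M. if e' = e then ?F x else 0)"
        using e disj by (intro sum.cong refl) (auto simp: indicator_def)
      then show "?F x = (\<Sum>e\<in>M. ?F x * indicator (interior e) x)" using e fin by simp
    qed
  qed
  then have "L2_norm_sq \<Omega> f = (\<integral>\<^sup>+x. (\<Sum>e\<in>M. ?F x * indicator (interior e) x) \<partial>lebesgue_on \<Omega>)"
    unfolding L2_norm_sq_def by (rule nn_integral_cong_AE)
  also have "\<dots> = (\<Sum>e\<in>M. \<integral>\<^sup>+x. ?F x * indicator (interior e) x \<partial>lebesgue_on \<Omega>)"
    by (rule nn_integral_sum) (rule borel_measurable_times_ennreal[OF Fm im])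
  also have "\<dots> = (\<Sum>e\<in>M. L2_norm_sq (interior e) f)"
    by (intro sum.cong refl part)
  finally show ?thesis .
qed

text \<open>
  The values of \<open>v\<close> off the interiors of the elements are arbitrary, but these points form a null set,
  on which every function is Lebesgue measurable.
\<close>

lemma piecewise_poly_in_L2_space:
  fixes v :: "'a::euclidean_space \<Rightarrow> 'b::euclidean_space"
  assumes \<Omega>: "open \<Omega>" and mesh: "is_mesh \<Omega> M" and neg: "\<And>e. e \<in> M \<Longrightarrow> negligible (frontier e)"
    and v: "\<And>e. e \<in> M \<Longrightarrow> \<exists>p. poly_deg_le r p \<and> (\<forall>x\<in>interior e. v x = p x)"
  shows "v \<in> L2_space \<Omega>"
proof -
  have fin: "finite M" and sub: "\<And>e. e \<in> M \<Longrightarrow> interior e \<subseteq> \<Omega>" and bdd: "\<And>e. e \<in> M \<Longrightarrow> bounded e"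
    using mesh unfolding is_mesh_def by auto
  let ?N = "\<Omega> - (\<Union>e\<in>M. interior e)"
  have N: "negligible ?N" by (rule mesh_cover[OF mesh neg])
  have restr: "restrict_space (lebesgue_on \<Omega>) X = lebesgue_on X" if "X \<subseteq> \<Omega>" "X \<in> sets lebesgue" for X
    using that \<Omega> by (simp add: restrict_restrict_space inf.absorb2)
  have meas: "v \<in> borel_measurable (lebesgue_on \<Omega>)"
  proof (rule measurable_piecewise_restrict[where C="insert ?N (interior ` M)"])
    show "countable (insert ?N (interior ` M))" using fin by (intro countable_finite) simp
    show "space (lebesgue_on \<Omega>) \<subseteq> \<Union> (insert ?N (interior ` M))" by (auto simp: space_restrict_space)
    fix X assume X: "X \<in> insert ?N (interior ` M)"
    then have X_sub: "X \<subseteq> \<Omega>" using sub by auto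
    have X_sets: "X \<in> sets lebesgue" using X negligible_imp_sets[OF N] by auto
    show "X \<inter> space (lebesgue_on \<Omega>) \<in> sets (lebesgue_on \<Omega>)"
      using X_sub X_sets \<Omega> by (simp add: sets_restrict_space_iff space_restrict_space inf.absorb1)
    have "v \<in> borel_measurable (lebesgue_on X)"
    proof (cases "X = ?N")
      case True
      show ?thesis
      proof (rule measurableI)
        fix A :: "'b set"
        have "v -` A \<inter> X \<subseteq> ?N" using True by auto
        then have "v -` A \<inter> X \<in> sets lebesgue" using negligible_subset[OF N] negligible_imp_sets by blast
        then show "v -` A \<inter> space (lebesgue_on X) \<in> sets (lebesgue_on X)"
          using X_sets by (simp add: sets_restrict_space_iff space_restrict_space)
      qed simp
    next
      case False
      then obtain e where e: "e \<in> M" "X = interior e" using X by auto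
      obtain p where p: "poly_deg_le r p" "\<forall>x\<in>X. v x = p x" using v[OF e(1)] e(2) by blast
      have "p \<in> borel_measurable (lebesgue_on X)"
        using X_sets by (intro continuous_imp_measurable_on_sets_lebesgue)
          (auto intro: continuous_on_subset[OF poly_deg_le_imp_continuous[OF p(1)]])
      then show ?thesis
        using p(2) by (subst measurable_cong[where g=p]) (auto simp: space_restrict_space)
    qed
    then show "v \<in> borel_measurable (restrict_space (lebesgue_on \<Omega>) X)"
      using restr[OF X_sub X_sets] by simp
  qed
  have "L2_norm_sq (interior e) v < \<infinity>" if e: "e \<in> M" for e
  proof -
    obtain p where p: "poly_deg_le r p" "\<forall>x\<in>interior e. v x = p x" using v[OF e] by blast
    note cont = poly_deg_le_imp_continuous[OF p(1)]
    obtain a R where aR: "e \<subseteq> cball a R" using bdd[OF e] bounded_subset_cball by metis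
    have "L2_norm_sq (interior e) v = L2_norm_sq (interior e) p"
      unfolding L2_norm_sq_def using p(2) by (intro nn_integral_cong) (simp add: space_restrict_space)
    also have "\<dots> \<le> L2_norm_sq (cball a R) p"
      using order_trans[OF interior_subset aR] by (intro L2_norm_sq_mono_set) auto
    also have "\<dots> = (\<integral>\<^sup>+x. ennreal (norm (indicator (cball a R) x *\<^sub>R (norm (p x))\<^sup>2)) \<partial>lborel)"
      by (subst L2_norm_sq_lborel) (auto intro!: nn_integral_cong simp: indicator_def)
    also have "\<dots> < \<infinity>"
    proof -
      have "continuous_on (cball a R) (\<lambda>x. (norm (p x))\<^sup>2)"
        by (intro continuous_on_power continuous_on_norm continuous_on_subset[OF cont]) auto
      from borel_integrable_compact[OF compact_cball this] show ?thesis
        unfolding integrable_iff_bounded by blast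
    qed
    finally show ?thesis .
  qed
  then have "L2_norm_sq \<Omega> v < \<infinity>"
    using L2_norm_sq_mesh[OF \<Omega> mesh neg meas] fin by (simp add: less_top)
  with meas show ?thesis by (simp add: L2_space_def)
qed

lemma sobolev_space_subset_L2_space:
  fixes u :: "'a::euclidean_space \<Rightarrow> 'b::euclidean_space"
  assumes \<Omega>: "open \<Omega>" and u: "u \<in> sobolev_space s \<Omega>"
  shows "u \<in> L2_space \<Omega>"
proof -
  obtain g where g: "g \<in> L2_space \<Omega>" "has_weak_deriv \<Omega> [] u g"
    using u unfolding sobolev_space_def by force
  have "AE x in lebesgue_on \<Omega>. g x = u x" using g(2) unfolding has_weak_deriv_def by simp
  then have "AE x in lebesgue_on \<Omega>. ennreal ((norm (u x))\<^sup>2) = ennreal ((norm (g x))\<^sup>2)"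
    by eventually_elim simp
  then have "L2_norm_sq \<Omega> u = L2_norm_sq \<Omega> g"
    unfolding L2_norm_sq_def by (rule nn_integral_cong_AE)
  moreover have "u \<in> borel_measurable (lebesgue_on \<Omega>)"
    using g(2) \<Omega> unfolding has_weak_deriv_def by (intro locally_integrable_measurable) auto
  ultimately show ?thesis using g(1) by (simp add: L2_space_def)
qed

section \<open>The projection and its error\<close>

lemma L2_norm_sq_add_le:
  fixes f g :: "'a::euclidean_space \<Rightarrow> 'b::euclidean_space"
  assumes f: "f \<in> borel_measurable (lebesgue_on S)" and g: "g \<in> borel_measurable (lebesgue_on S)"
  shows "L2_norm_sq S (\<lambda>x. f x + g x) \<le> 2 * L2_norm_sq S f + 2 * L2_norm_sq S g"
proof -
  have m: "(\<lambda>x. ennreal ((norm (f x))\<^sup>2)) \<in> borel_measurable (lebesgue_on S)"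
    "(\<lambda>x. ennreal ((norm (g x))\<^sup>2)) \<in> borel_measurable (lebesgue_on S)"
    using f g by measurable
  have "L2_norm_sq S (\<lambda>x. f x + g x)
     \<le> (\<integral>\<^sup>+x. 2 * ennreal ((norm (f x))\<^sup>2) + 2 * ennreal ((norm (g x))\<^sup>2) \<partial>lebesgue_on S)"
    unfolding L2_norm_sq_def
  proof (rule nn_integral_mono)
    fix x
    have "ennreal ((norm (f x + g x))\<^sup>2) \<le> ennreal (2 * (norm (f x))\<^sup>2 + 2 * (norm (g x))\<^sup>2)"
      by (intro ennreal_leI norm_add_squared_le)
    then show "ennreal ((norm (f x + g x))\<^sup>2) \<le> 2 * ennreal ((norm (f x))\<^sup>2) + 2 * ennreal ((norm (g x))\<^sup>2)"
      by (simp add: ennreal_mult')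
  qed
  also have "\<dots> = 2 * L2_norm_sq S f + 2 * L2_norm_sq S g"
    unfolding L2_norm_sq_def nn_integral_cmult[OF m(1), symmetric] nn_integral_cmult[OF m(2), symmetric]
    by (rule nn_integral_add) (rule borel_measurable_times_ennreal[OF borel_measurable_const m(1)]
          borel_measurable_times_ennreal[OF borel_measurable_const m(2)])+
  finally show ?thesis .
qed

lemma L2_norm_sq_minus_commute: "L2_norm_sq S (\<lambda>x. f x - g x) = L2_norm_sq S (\<lambda>x. g x - f x)"
  unfolding L2_norm_sq_def by (simp add: norm_minus_commute)

lemma L2_space_diff:
  fixes f g :: "'a::euclidean_space \<Rightarrow> 'b::euclidean_space"
  assumes "f \<in> L2_space S" "g \<in> L2_space S"
  shows "(\<lambda>x. f x - g x) \<in> L2_space S"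
proof -
  have m: "f \<in> borel_measurable (lebesgue_on S)" "(\<lambda>x. - g x) \<in> borel_measurable (lebesgue_on S)"
    using assms by (auto simp: L2_space_def)
  have "L2_norm_sq S (\<lambda>x. f x + - g x) \<le> 2 * L2_norm_sq S f + 2 * L2_norm_sq S (\<lambda>x. - g x)"
    by (rule L2_norm_sq_add_le[OF m])
  also have "L2_norm_sq S (\<lambda>x. - g x) = L2_norm_sq S g" by (simp add: L2_norm_sq_def)
  also have "2 * L2_norm_sq S f + 2 * L2_norm_sq S g < \<infinity>"
    using assms by (auto simp: L2_space_def ennreal_mult_less_top)
  finally show ?thesis using m by (simp add: L2_space_def)
qed

lemma
  fixes f g :: "'a::euclidean_space \<Rightarrow> 'b::euclidean_space"
  assumes f: "f \<in> L2_space S" and g: "g \<in> L2_space S"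
  shows integrable_norm_squared: "integrable (lebesgue_on S) (\<lambda>x. (norm (f x))\<^sup>2)"
    and integrable_inner: "integrable (lebesgue_on S) (\<lambda>x. f x \<bullet> g x)"
proof -
  have sq: "integrable (lebesgue_on S) (\<lambda>x. (norm (q x))\<^sup>2)" if "q \<in> L2_space S" for q :: "'a \<Rightarrow> 'b"
    using that by (auto simp: L2_space_def L2_norm_sq_def integrable_iff_bounded)
  show "integrable (lebesgue_on S) (\<lambda>x. (norm (f x))\<^sup>2)" by (rule sq[OF f])
  show "integrable (lebesgue_on S) (\<lambda>x. f x \<bullet> g x)"
  proof (rule Bochner_Integration.integrable_bound[OF Bochner_Integration.integrable_add[OF sq[OF f] sq[OF g]]])
    show "(\<lambda>x. f x \<bullet> g x) \<in> borel_measurable (lebesgue_on S)"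
      using f g by (intro borel_measurable_inner) (auto simp: L2_space_def)
    have "norm (f x \<bullet> g x) \<le> norm ((norm (f x))\<^sup>2 + (norm (g x))\<^sup>2)" for x
    proof -
      have "\<bar>f x \<bullet> g x\<bar> \<le> norm (f x) * norm (g x)" by (rule Cauchy_Schwarz_ineq2)
      also have "\<dots> \<le> (norm (f x))\<^sup>2 + (norm (g x))\<^sup>2"
        using sum_squares_bound[of "norm (f x)" "norm (g x)"] mult_nonneg_nonneg[OF norm_ge_zero norm_ge_zero, of "f x" "g x"]
        by linarith
      finally show ?thesis by simp
    qed
    then show "AE x in lebesgue_on S. norm (f x \<bullet> g x) \<le> norm ((norm (f x))\<^sup>2 + (norm (g x))\<^sup>2)" by simp
  qed
qed

text \<open>
  A contraction property from Young's inequality alone: \<open>\<parallel>v\<parallel>\<^sup>2 = (g, v) \<le> (\<parallel>g\<parallel>\<^sup>2 + \<parallel>v\<parallel>\<^sup>2) / 2\<close>.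
\<close>

lemma L2_norm_sq_le_if_L2_inner_eq:
  fixes g v :: "'a::euclidean_space \<Rightarrow> 'b::euclidean_space"
  assumes g: "g \<in> L2_space S" and v: "v \<in> L2_space S" and eq: "L2_inner S v v = L2_inner S g v"
  shows "L2_norm_sq S v \<le> L2_norm_sq S g"
proof -
  note i = integrable_norm_squared[OF g g] integrable_norm_squared[OF v v] integrable_inner[OF g v]
  have n: "L2_norm_sq S q = ennreal (\<integral>x. (norm (q x))\<^sup>2 \<partial>lebesgue_on S)" if "q \<in> L2_space S" for q :: "'a \<Rightarrow> 'b"
    unfolding L2_norm_sq_def using integrable_norm_squared[OF that that] by (rule nn_integral_eq_integral) simp
  have "2 * (\<integral>x. (norm (v x))\<^sup>2 \<partial>lebesgue_on S) = (\<integral>x. 2 * (g x \<bullet> v x) \<partial>lebesgue_on S)"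
    using eq by (simp add: L2_inner_def power2_norm_eq_inner)
  also have "\<dots> \<le> (\<integral>x. (norm (g x))\<^sup>2 + (norm (v x))\<^sup>2 \<partial>lebesgue_on S)"
  proof (rule integral_mono)
    fix x
    have "0 \<le> (norm (g x - v x))\<^sup>2" by simp
    also have "\<dots> = (norm (g x))\<^sup>2 + (norm (v x))\<^sup>2 - 2 * (g x \<bullet> v x)"
      by (simp add: power2_norm_eq_inner inner_diff_left inner_diff_right inner_commute)
    finally show "2 * (g x \<bullet> v x) \<le> (norm (g x))\<^sup>2 + (norm (v x))\<^sup>2" by simp
  qed (use i in auto)
  also have "\<dots> = (\<integral>x. (norm (g x))\<^sup>2 \<partial>lebesgue_on S) + (\<integral>x. (norm (v x))\<^sup>2 \<partial>lebesgue_on S)"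
    using i by simp
  finally show ?thesis unfolding n[OF g] n[OF v] by (intro ennreal_leI) simp
qed

text \<open>
  Since \<open>w\<close> lies in \<open>V\<close>, the function \<open>v = w - P g\<close> is the projection of \<open>w - g\<close>, and projecting does
  not increase the norm; it suffices to test the defining property of \<open>P g\<close> with \<open>v\<close> itself.
\<close>

lemma L2_projection_error_le:
  fixes w g :: "'a::euclidean_space \<Rightarrow> 'b::euclidean_space"
  assumes V: "linear_space V" "V \<subseteq> L2_space \<Omega>" and P: "is_L2_projection \<Omega> V P"
    and w: "w \<in> V" and g: "g \<in> L2_space \<Omega>"
  shows "(\<lambda>x. w x - P g x) \<in> V"
    and "L2_norm_sq \<Omega> (\<lambda>x. w x - P g x) \<le> L2_norm_sq \<Omega> (\<lambda>x. w x - g x)"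
proof -
  have Pg: "P g \<in> V" and orth: "\<And>v. v \<in> V \<Longrightarrow> L2_inner \<Omega> (P g) v = L2_inner \<Omega> g v"
    using P g unfolding is_L2_projection_def by auto
  have add: "(\<lambda>x. p x + q x) \<in> V" and scale: "(\<lambda>x. a *\<^sub>R p x) \<in> V"
    if "p \<in> V" "q \<in> V" for p q and a :: real
    using V(1) that unfolding linear_space_def by blast+
  from add[OF w scale[OF Pg Pg, of "- 1"]]
  show v: "(\<lambda>x. w x - P g x) \<in> V" by simp
  let ?v = "\<lambda>x. w x - P g x"
  have L2: "w \<in> L2_space \<Omega>" "P g \<in> L2_space \<Omega>" "?v \<in> L2_space \<Omega>" using w Pg v V(2) by auto
  have lin: "L2_inner \<Omega> (\<lambda>x. w x - q x) ?v = L2_inner \<Omega> w ?v - L2_inner \<Omega> q ?v" if "q \<in> L2_space \<Omega>" for q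
    unfolding L2_inner_def inner_diff_left
    by (rule Bochner_Integration.integral_diff[OF integrable_inner[OF L2(1,3)] integrable_inner[OF that L2(3)]])
  show "L2_norm_sq \<Omega> ?v \<le> L2_norm_sq \<Omega> (\<lambda>x. w x - g x)"
    by (rule L2_norm_sq_le_if_L2_inner_eq[OF L2_space_diff[OF L2(1) g] L2(3)])
       (simp only: lin[OF L2(2)] lin[OF g] orth[OF v])
qed

lemma error_lhs_add_piecewise_poly:
  "\<exists>K\<ge>0. \<forall>(\<Omega> :: 'a::euclidean_space set) M (f :: 'a \<Rightarrow> 'b::euclidean_space) v.
     open \<Omega> \<longrightarrow> is_mesh \<Omega> M \<longrightarrow> (\<forall>e\<in>M. regular_element \<gamma> e) \<longrightarrow>
     (\<forall>e\<in>M. \<exists>p. poly_deg_le r p \<and> (\<forall>x\<in>interior e. v x = p x)) \<longrightarrow>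
     error_lhs t M (\<lambda>x. f x + v x) \<le> 2 * error_lhs t M f + ennreal K * L2_norm_sq \<Omega> v"
proof -
  define Q where "Q m K \<longleftrightarrow> (\<forall>(e :: 'a set) (f :: 'a \<Rightarrow> 'b) v p.
     regular_element \<gamma> e \<longrightarrow> poly_deg_le r p \<longrightarrow> (\<forall>x\<in>interior e. v x = p x) \<longrightarrow>
     ennreal (outer_diam e ^ (2 * m)) * grad_norm_sq m e (\<lambda>x. f x + v x)
       \<le> 2 * (ennreal (outer_diam e ^ (2 * m)) * grad_norm_sq m e f) + ennreal K * L2_norm_sq (interior e) v)" for m K
  have "\<forall>m. \<exists>K\<ge>0. Q m K"
    unfolding Q_def by (intro allI element_inverse_estimate)
  then obtain K where K0: "\<And>m. 0 \<le> K m" and Q: "\<And>m. Q m (K m)" by metis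
  note K = Q[unfolded Q_def, rule_format]
  show ?thesis
  proof (intro exI[of _ "\<Sum>m=0..t. K m"] conjI allI impI)
    show "0 \<le> (\<Sum>m=0..t. K m)" by (intro sum_nonneg K0)
    fix \<Omega> :: "'a set" and M and f v :: "'a \<Rightarrow> 'b"
    assume \<Omega>: "open \<Omega>" and mesh: "is_mesh \<Omega> M" and reg: "\<forall>e\<in>M. regular_element \<gamma> e"
      and v: "\<forall>e\<in>M. \<exists>p. poly_deg_le r p \<and> (\<forall>x\<in>interior e. v x = p x)"
    have neg: "negligible (frontier e)" if "e \<in> M" for e
      using reg that unfolding regular_element_def by blast
    have "v \<in> L2_space \<Omega>"
      using v by (intro piecewise_poly_in_L2_space[OF \<Omega> mesh neg]) auto
    then have vm: "v \<in> borel_measurable (lebesgue_on \<Omega>)" by (simp add: L2_space_def)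
    have "error_lhs t M (\<lambda>x. f x + v x) \<le> (\<Sum>m=0..t. \<Sum>e\<in>M.
       2 * (ennreal (outer_diam e ^ (2 * m)) * grad_norm_sq m e f) + ennreal (K m) * L2_norm_sq (interior e) v)"
      unfolding error_lhs_def
    proof (intro sum_mono)
      fix m e assume "e \<in> M"
      then obtain p where p: "poly_deg_le r p" "\<forall>x\<in>interior e. v x = p x" using v by blast
      show "ennreal (outer_diam e ^ (2 * m)) * grad_norm_sq m e (\<lambda>x. f x + v x)
       \<le> 2 * (ennreal (outer_diam e ^ (2 * m)) * grad_norm_sq m e f) + ennreal (K m) * L2_norm_sq (interior e) v"
        using reg \<open>e \<in> M\<close> p by (intro K[where p=p]) auto
    qed
    also have "\<dots> = 2 * error_lhs t M f + (\<Sum>m=0..t. ennreal (K m) * L2_norm_sq \<Omega> v)"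
      using L2_norm_sq_mesh[OF \<Omega> mesh neg vm]
      by (simp only: error_lhs_def sum.distrib sum_distrib_left)
    also have "(\<Sum>m=0..t. ennreal (K m) * L2_norm_sq \<Omega> v) = ennreal (\<Sum>m=0..t. K m) * L2_norm_sq \<Omega> v"
      by (simp add: sum_distrib_right[symmetric] sum_ennreal K0)
    finally show "error_lhs t M (\<lambda>x. f x + v x) \<le> 2 * error_lhs t M f + ennreal (\<Sum>m=0..t. K m) * L2_norm_sq \<Omega> v" .
  qed
qed

lemma L2_norm_sq_le_error_lhs:
  fixes f :: "'a::euclidean_space \<Rightarrow> 'b::euclidean_space"
  assumes \<Omega>: "open \<Omega>" and mesh: "is_mesh \<Omega> M" and neg: "\<And>e. e \<in> M \<Longrightarrow> negligible (frontier e)"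
    and f: "f \<in> borel_measurable (lebesgue_on \<Omega>)"
  shows "L2_norm_sq \<Omega> f \<le> error_lhs t M f"
proof -
  have "L2_norm_sq \<Omega> f = (\<Sum>e\<in>M. L2_norm_sq (interior e) f)"
    by (rule L2_norm_sq_mesh[OF \<Omega> mesh neg f])
  also have "\<dots> \<le> (\<Sum>e\<in>M. ennreal (outer_diam e ^ (2 * 0)) * grad_norm_sq 0 e f)"
    by (intro sum_mono) (simp add: L2_norm_sq_interior_le_grad_norm_sq_0 neg)
  also have "\<dots> \<le> error_lhs t M f"
    unfolding error_lhs_def
    by (rule member_le_sum[where i=0 and f="\<lambda>m. \<Sum>e\<in>M. ennreal (outer_diam e ^ (2 * m)) * grad_norm_sq m e f"]) auto
  finally show ?thesis .
qed

text \<open>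
  With \<open>v = w - P u\<^sub>h\<close>, the error is \<open>(u - w) + v\<close>. The first part is the interpolation error; the inverse
  estimate bounds the second by the \<open>L\<^sup>2\<close> norm of \<open>v\<close>, hence by that of
  \<open>w - u\<^sub>h = (w - u) + (u - u\<^sub>h)\<close>. Negative \<open>A\<close> and \<open>B\<close> count as zero, as in \<^const>\<open>ennreal\<close>.
\<close>

lemma projection_error_estimate:
  fixes u u\<^sub>h w :: "'a::euclidean_space \<Rightarrow> 'b::euclidean_space"
  assumes K0: "0 \<le> K" and K: "\<And>f v :: 'a \<Rightarrow> 'b. \<forall>e\<in>M. \<exists>p. poly_deg_le r p \<and> (\<forall>x\<in>interior e. v x = p x) \<Longrightarrow>
     error_lhs t M (\<lambda>x. f x + v x) \<le> 2 * error_lhs t M f + ennreal K * L2_norm_sq \<Omega> v"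
    and \<Omega>: "open \<Omega>" and mesh: "is_mesh \<Omega> M" and neg: "\<And>e. e \<in> M \<Longrightarrow> negligible (frontier e)"
    and V: "piecewise_poly_space k r M V" and P: "is_L2_projection \<Omega> V P"
    and u: "u \<in> L2_space \<Omega>" and u\<^sub>h: "u\<^sub>h \<in> L2_space \<Omega>" and w: "w \<in> V"
    and interp: "error_lhs t M (\<lambda>x. u x - w x) \<le> ennreal A * N"
    and approx: "L2_norm_sq \<Omega> (\<lambda>x. u x - u\<^sub>h x) \<le> ennreal B * N"
  shows "error_lhs t M (\<lambda>x. u x - P u\<^sub>h x)
    \<le> ennreal (2 * max A 0 + K * (2 * max A 0 + 2 * max B 0)) * N"
proof -
  have lin: "linear_space V" and pp: "\<And>v. v \<in> V \<Longrightarrow> \<forall>e\<in>M. \<exists>p. poly_deg_le r p \<and> (\<forall>x\<in>interior e. v x = p x)"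
    using V unfolding piecewise_poly_space_def by auto
  have "V \<subseteq> L2_space \<Omega>"
    using piecewise_poly_in_L2_space[OF \<Omega> mesh neg] pp by blast
  note proj = L2_projection_error_le[OF lin this P w u\<^sub>h]
  define A' B' where "A' = max A 0" and "B' = max B 0"
  have AB: "0 \<le> A'" "0 \<le> B'" "ennreal A = ennreal A'" "ennreal B = ennreal B'"
    by (auto simp: A'_def B'_def max_def ennreal_neg)
  have wL2: "w \<in> L2_space \<Omega>" using w \<open>V \<subseteq> L2_space \<Omega>\<close> by blast
  have m: "(\<lambda>x. w x - u x) \<in> borel_measurable (lebesgue_on \<Omega>)" "(\<lambda>x. u x - w x) \<in> borel_measurable (lebesgue_on \<Omega>)"
    "(\<lambda>x. u x - u\<^sub>h x) \<in> borel_measurable (lebesgue_on \<Omega>)"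
    using L2_space_diff[OF wL2 u] L2_space_diff[OF u wL2] L2_space_diff[OF u u\<^sub>h] by (auto simp: L2_space_def)
  have "L2_norm_sq \<Omega> (\<lambda>x. w x - P u\<^sub>h x) \<le> L2_norm_sq \<Omega> (\<lambda>x. (w x - u x) + (u x - u\<^sub>h x))"
    using proj(2) by simp
  also have "\<dots> \<le> 2 * L2_norm_sq \<Omega> (\<lambda>x. w x - u x) + 2 * L2_norm_sq \<Omega> (\<lambda>x. u x - u\<^sub>h x)"
    by (rule L2_norm_sq_add_le[OF m(1,3)])
  also have "\<dots> \<le> 2 * (ennreal A' * N) + 2 * (ennreal B' * N)"
    using order_trans[OF L2_norm_sq_le_error_lhs[OF \<Omega> mesh neg m(2)] interp] approx
    unfolding AB(3,4) L2_norm_sq_minus_commute[of \<Omega> w u] by (intro add_mono mult_left_mono) auto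
  finally have v: "L2_norm_sq \<Omega> (\<lambda>x. w x - P u\<^sub>h x) \<le> 2 * (ennreal A' * N) + 2 * (ennreal B' * N)" .
  have "error_lhs t M (\<lambda>x. u x - P u\<^sub>h x) = error_lhs t M (\<lambda>x. (u x - w x) + (w x - P u\<^sub>h x))"
    by simp
  also have "\<dots> \<le> 2 * error_lhs t M (\<lambda>x. u x - w x) + ennreal K * L2_norm_sq \<Omega> (\<lambda>x. w x - P u\<^sub>h x)"
    by (rule K[OF pp[OF proj(1)]])
  also have "\<dots> \<le> 2 * (ennreal A' * N) + ennreal K * (2 * (ennreal A' * N) + 2 * (ennreal B' * N))"
    using interp v unfolding AB(3) by (intro add_mono mult_left_mono) auto
  also have "\<dots> = ennreal (2 * A' + K * (2 * A' + 2 * B')) * N"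
    using K0 AB(1,2) by (simp add: ennreal_mult' distrib_left distrib_right mult.assoc)
  finally show ?thesis unfolding A'_def B'_def .
qed

theorem theorem3p4:
  fixes k t r D :: nat and \<gamma> C_I C :: real
  assumes "0 < D"
  shows "\<exists>C'::real. 
    \<forall>(\<Omega> :: 'a::euclidean_space set) (H :: ('a \<Rightarrow> real) set) (M :: ('a \<Rightarrow> real) \<Rightarrow> 'a set set)
     (V :: ('a \<Rightarrow> real) \<Rightarrow> ('a \<Rightarrow> 'b::euclidean_space) set)
     (W :: ('a \<Rightarrow> real) \<Rightarrow> ('a \<Rightarrow> 'b) set)
     (Ih :: ('a \<Rightarrow> real) \<Rightarrow> ('a \<Rightarrow> 'b) \<Rightarrow> ('a \<Rightarrow> 'b))
     (Pr :: ('a \<Rightarrow> real) \<Rightarrow> ('a \<Rightarrow> 'b) \<Rightarrow> ('a \<Rightarrow> 'b)).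
      is_domain \<Omega> \<longrightarrow>
      (\<forall>h\<in>H. is_mesh \<Omega> (M h)) \<longrightarrow>
      nondegenerate \<gamma> D H M \<longrightarrow>
      (\<forall>h\<in>H. piecewise_poly_space k r (M h) (V h)) \<longrightarrow>
      (\<forall>h\<in>H. \<forall>w\<in>sobolev_space (k + 1) \<Omega>.
         Ih h w \<in> V h \<and>
         error_lhs t (M h) (\<lambda>x. w x - Ih h w x) \<le> ennreal C_I * error_rhs k (M h) w) \<longrightarrow>
      (\<forall>h\<in>H. finite_element_space \<Omega> (M h) (W h)) \<longrightarrow>
      (\<forall>h\<in>H. is_L2_projection \<Omega> (V h) (Pr h)) \<longrightarrow>
      (\<forall>u\<in>sobolev_space (k + 1) \<Omega>. \<forall>h\<in>H. \<forall>u\<^sub>h\<in>W h.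
         L2_norm_sq \<Omega> (\<lambda>x. u x - u\<^sub>h x) \<le> ennreal C * error_rhs k (M h) u \<longrightarrow>
         error_lhs t (M h) (\<lambda>x. u x - Pr h u\<^sub>h x) \<le> ennreal C' * error_rhs k (M h) u)"
proof -
  obtain K where K0: "0 \<le> K" and K: "\<And>(\<Omega> :: 'a set) M (f :: 'a \<Rightarrow> 'b) v.
     \<lbrakk>open \<Omega>; is_mesh \<Omega> M; \<forall>e\<in>M. regular_element \<gamma> e;
      \<forall>e\<in>M. \<exists>p. poly_deg_le r p \<and> (\<forall>x\<in>interior e. v x = p x)\<rbrakk> \<Longrightarrow>
     error_lhs t M (\<lambda>x. f x + v x) \<le> 2 * error_lhs t M f + ennreal K * L2_norm_sq \<Omega> v"
    using error_lhs_add_piecewise_poly[of \<gamma> r t, where 'a='a and 'b='b] by blast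
  show ?thesis
  proof (intro exI[of _ "2 * max C_I 0 + K * (2 * max C_I 0 + 2 * max C 0)"] allI impI ballI)
    fix \<Omega> :: "'a set" and H :: "('a \<Rightarrow> real) set" and M :: "('a \<Rightarrow> real) \<Rightarrow> 'a set set"
      and V W :: "('a \<Rightarrow> real) \<Rightarrow> ('a \<Rightarrow> 'b) set"
      and Ih Pr :: "('a \<Rightarrow> real) \<Rightarrow> ('a \<Rightarrow> 'b) \<Rightarrow> ('a \<Rightarrow> 'b)"
      and u u\<^sub>h :: "'a \<Rightarrow> 'b" and h :: "'a \<Rightarrow> real"
    assume dom: "is_domain \<Omega>" and mesh: "\<forall>h\<in>H. is_mesh \<Omega> (M h)" and nd: "nondegenerate \<gamma> D H M"
      and V: "\<forall>h\<in>H. piecewise_poly_space k r (M h) (V h)"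
      and I: "\<forall>h\<in>H. \<forall>w\<in>sobolev_space (k + 1) \<Omega>. Ih h w \<in> V h \<and>
         error_lhs t (M h) (\<lambda>x. w x - Ih h w x) \<le> ennreal C_I * error_rhs k (M h) w"
      and W: "\<forall>h\<in>H. finite_element_space \<Omega> (M h) (W h)"
      and P: "\<forall>h\<in>H. is_L2_projection \<Omega> (V h) (Pr h)"
      and u: "u \<in> sobolev_space (k + 1) \<Omega>" and h: "h \<in> H" and u\<^sub>h: "u\<^sub>h \<in> W h"
      and approx: "L2_norm_sq \<Omega> (\<lambda>x. u x - u\<^sub>h x) \<le> ennreal C * error_rhs k (M h) u"
    have \<Omega>: "open \<Omega>" using dom unfolding is_domain_def by blast
    have mesh_h: "is_mesh \<Omega> (M h)" using mesh h by blast
    have reg: "\<forall>e\<in>M h. regular_element \<gamma> e"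
      using nondegenerate_imp_regular_element[where M=M, OF nd h _ mesh_h] by blast
    have neg: "negligible (frontier e)" if "e \<in> M h" for e
      using reg that unfolding regular_element_def by blast
    have u\<^sub>h_L2: "u\<^sub>h \<in> L2_space \<Omega>" using W h u\<^sub>h unfolding finite_element_space_def by blast
    have V_h: "piecewise_poly_space k r (M h) (V h)" and P_h: "is_L2_projection \<Omega> (V h) (Pr h)"
      using V P h by auto
    have I_h: "Ih h u \<in> V h" "error_lhs t (M h) (\<lambda>x. u x - Ih h u x) \<le> ennreal C_I * error_rhs k (M h) u"
      using I u h by auto
    show "error_lhs t (M h) (\<lambda>x. u x - Pr h u\<^sub>h x)
        \<le> ennreal (2 * max C_I 0 + K * (2 * max C_I 0 + 2 * max C 0)) * error_rhs k (M h) u"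
      by (rule projection_error_estimate[OF K0 K[OF \<Omega> mesh_h reg] \<Omega> mesh_h neg V_h P_h
            sobolev_space_subset_L2_space[OF \<Omega> u] u\<^sub>h_L2 I_h approx])
  qed
qed

end
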